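(* For every $n\ge1$ there is a constant $C_n>0$, depending only on $n$, such that the following holds. Let $p,q\in(1,\infty)$ and let $v,w$ be weights on $\mathbb R^n$ with $(v,w)\in A_1$ and $w\in A_1$. Then the operator $Tf:=\frac{\mathrm M(fv)}{w}$ satisfies $$\|T\|_{L^{p',q'}(v)\to L^{p',q'}(w)}\le C_n\,p^{\frac1{\min(p',q')}}\,\log\big(e+[v,w]_{A_1}\big)^{\frac1{\min(p',q')}}\,\big(1+[v,w]_{A_1}\big)\,[w]_{A_1}^{\frac1{p'}}.$$
   Context: Cubes are cubes in $\mathbb R^n$. The Hardy–Littlewood maximal operator is $\mathrm Mf(x)=\sup_{Q\ni x}\frac1{|Q|}\int_Q|f(y)|\,dy$, the supremum over all cubes $Q$ containing $x$. A weight is a locally integrable function positive a.e.; $w(E)=\int_E w\,dx$. For $1<p<\infty$, $p'=\frac p{p-1}$. For two weights $v,w$, $[v,w]_{A_1}:=\operatorname{ess\,sup}_{x\in\mathbb R^n}\frac{\mathrm Mv(x)}{w(x)}$, and $(v,w)\in A_1$ means $[v,w]_{A_1}<\infty$; $[w]_{A_1}:=[w,w]_{A_1}$, and $w\in A_1$ means $[w]_{A_1}<\infty$. Lorentz spaces: for $s,t\in(0,\infty)$, $\|f\|_{L^{s,t}(w)}:=\big(s\int_0^\infty \lambda^t\,w(\{|f|>\lambda\})^{t/s}\frac{d\lambda}\lambda\big)^{1/t}$. For function spaces $X,Y$, $\|T\|_{X\to Y}:=\sup_{0\ne f\in X}\|Tf\|_Y/\|f\|_X$. *)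

theory Defs
  imports "HOL-Analysis.Analysis" "HOL-Probability.Essential_Supremum"
begin

text \<open>
  Norms, weight constants and values of the maximal operator live in \<^typ>\<open>ennreal\<close>, so that
  they may be infinite. "Measurable" means Lebesgue measurable throughout.
\<close>

definition cubes :: "(real ^ 'n) set set" where
  "cubes = {cbox a (a + (\<chi> i. h)) | a h. h > 0}"

definition maximal :: "(real ^ 'n \<Rightarrow> real) \<Rightarrow> real ^ 'n \<Rightarrow> ennreal" where
  "maximal f x =
     (SUP Q \<in> {Q \<in> cubes. x \<in> Q}.
        (\<integral>\<^sup>+ y \<in> Q. ennreal \<bar>f y\<bar> \<partial>lebesgue) / emeasure lebesgue Q)"

definition weight :: "(real ^ 'n \<Rightarrow> real) \<Rightarrow> bool" where
  "weight w \<longleftrightarrow>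
     w \<in> borel_measurable lebesgue \<and>
     (\<forall>K. compact K \<longrightarrow> w absolutely_integrable_on K) \<and>
     (AE x in lebesgue. w x > 0)"

definition wmeas :: "(real ^ 'n \<Rightarrow> real) \<Rightarrow> (real ^ 'n) set \<Rightarrow> ennreal" where
  "wmeas w E = (\<integral>\<^sup>+ x \<in> E. ennreal (w x) \<partial>lebesgue)"

definition A1_const :: "(real ^ 'n \<Rightarrow> real) \<Rightarrow> (real ^ 'n \<Rightarrow> real) \<Rightarrow> ennreal" where
  "A1_const v w = esssup lebesgue (\<lambda>x. maximal v x / ennreal (w x))"

definition conj_exp :: "real \<Rightarrow> real" where
  "conj_exp p = p / (p - 1)"

text \<open>Only meaningful for exponents \<open>a > 0\<close>; then \<open>0\<close> and \<open>\<infinity>\<close> are mapped to themselves.\<close>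

definition epowr :: "ennreal \<Rightarrow> real \<Rightarrow> ennreal" where
  "epowr x a = (if x = \<infinity> then \<infinity> else ennreal (enn2real x powr a))"

text \<open>
  The Lorentz norm takes the modulus \<open>g = \<bar>f\<bar>\<close> as its argument, since the maximal operator
  produces functions with values in \<open>[0, \<infinity>]\<close>.
\<close>

definition lorentz_norm ::
    "real \<Rightarrow> real \<Rightarrow> (real ^ 'n \<Rightarrow> real) \<Rightarrow> (real ^ 'n \<Rightarrow> ennreal) \<Rightarrow> ennreal" where
  "lorentz_norm s t w g =
     epowr (ennreal s *
       (\<integral>\<^sup>+ l \<in> {0<..}.
          ennreal (l powr t) * epowr (wmeas w {x. g x > ennreal l}) (t / s) / ennreal l
        \<partial>lborel)) (1 / t)"

definition lorentz_space ::
    "real \<Rightarrow> real \<Rightarrow> (real ^ 'n \<Rightarrow> real) \<Rightarrow> (real ^ 'n \<Rightarrow> real) set" where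
  "lorentz_space s t w =
     {f \<in> borel_measurable lebesgue. lorentz_norm s t w (\<lambda>x. ennreal \<bar>f x\<bar>) < \<infinity>}"

text \<open>
  The norm of \<open>T\<close> from \<open>L\<^sup>s\<^sup>,\<^sup>t(v)\<close> to \<open>L\<^sup>s\<^sup>,\<^sup>t(w)\<close>. Functions are identified when they agree almost
  everywhere, so \<open>f \<noteq> 0\<close> means that \<open>f\<close> does not vanish almost everywhere.
\<close>

definition lorentz_op_norm ::
    "real \<Rightarrow> real \<Rightarrow> (real ^ 'n \<Rightarrow> real) \<Rightarrow> (real ^ 'n \<Rightarrow> real) \<Rightarrow>
     ((real ^ 'n \<Rightarrow> real) \<Rightarrow> real ^ 'n \<Rightarrow> ennreal) \<Rightarrow> ennreal" where
  "lorentz_op_norm s t v w T =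
     (SUP f \<in> {f \<in> lorentz_space s t v. \<not> (AE x in lebesgue. f x = 0)}.
        lorentz_norm s t w (T f) / lorentz_norm s t v (\<lambda>x. ennreal \<bar>f x\<bar>))"

definition weighted_maximal ::
    "(real ^ 'n \<Rightarrow> real) \<Rightarrow> (real ^ 'n \<Rightarrow> real) \<Rightarrow> (real ^ 'n \<Rightarrow> real) \<Rightarrow> real ^ 'n \<Rightarrow> ennreal" where
  "weighted_maximal v w f x = maximal (\<lambda>y. f y * v y) x / ennreal (w x)"

end

theory Submission
  imports Defs
begin

text \<open>
  Let \<open>A = [v,w]\<close> and \<open>W = [w]\<close> denote the two \<open>A\<^sub>1\<close> constants and let \<open>r\<close>, \<open>t\<close> be the conjugate
  exponents of \<open>p\<close>, \<open>q\<close>. The estimate interpolates between two endpoint bounds for the sublinear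
  operator \<open>T f = M(f v) / w\<close>.

  The first endpoint is \<open>L\<^sup>\<infinity>\<close>: pointwise, \<open>M(f v) \<le> \<bar>f\<bar>\<^sub>\<infinity> M v \<le> \<bar>f\<bar>\<^sub>\<infinity> A w\<close> almost everywhere.

  The second is the weak type bound \<open>\<lambda> w{M g > \<lambda> w} \<le> c W \<parallel>g\<parallel>\<^sub>1\<close> with \<open>c = (5n)\<^sup>n\<close>, whose linear
  dependence on \<open>W\<close> is essential (\<open>weak_type_maximal_A1\<close>). If \<open>M g(x) > \<lambda> w(x)\<close>, there is a cube \<open>Q\<close>
  around \<open>x\<close> on which the integral of \<open>\<bar>g\<bar>\<close> exceeds \<open>\<lambda> w(x) \<bar>Q\<bar>\<close>. A dilate \<open>Q*\<close> of \<open>Q\<close> contains the same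
  point \<open>x\<close>, so the \<open>A\<^sub>1\<close> condition at \<open>x\<close> gives \<open>w(Q*) \<le> W w(x) \<bar>Q*\<bar> \<le> (c W / \<lambda>) \<integral>\<^sub>Q \<bar>g\<bar>\<close>. Applying
  the \<open>A\<^sub>1\<close> condition directly to the dilate avoids a doubling estimate for \<open>w\<close>, which would cost a
  second factor \<open>W\<close>. Vitali's covering lemma makes the cubes \<open>Q\<close> disjoint while the cubes \<open>Q*\<close> still
  cover, and summing yields the bound.

  To interpolate, put \<open>B = 1 + A\<close> and bound \<open>\<bar>f\<bar> \<le> s + (\<bar>f\<bar> - s)\<^sup>+\<close>. The first part contributes at most
  \<open>A s\<close> to \<open>T f\<close>; the second has \<open>L\<^sup>1(v)\<close> norm \<open>\<integral>\<^sub>s\<^sup>\<infinity> d(u) du\<close>, where \<open>d(u) = v{\<bar>f\<bar> > u}\<close>. Hence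
  \<open>w{T f > 2 B s} \<le> (c W / B) (1/s) \<integral>\<^sub>s\<^sup>\<infinity> d(u) du\<close> (\<open>distribution_weighted_maximal_le\<close>). Inserted into the
  Lorentz norm, this reduces the theorem to a Hardy inequality for the decreasing function \<open>d\<close>
  (\<open>Hardy_tail\<close>), whose constant behaves like \<open>p\<close> to the power \<open>max 1 (t / r)\<close> because the
  bound for the averages \<open>(1/s) \<integral>\<^sub>s\<^sup>\<infinity> d(u) du\<close> degenerates as \<open>r\<close> tends to \<open>1\<close>. Taking \<open>t\<close>-th roots gives the factors
  \<open>B (W / B)\<^sup>1\<^sup>/\<^sup>r \<le> B W\<^sup>1\<^sup>/\<^sup>r\<close> and \<open>p\<close> to the power \<open>1 / min r t\<close>.
\<close>

section \<open>Real powers of extended nonnegative numbers\<close>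

lemma epowr_ennreal: "0 \<le> x \<Longrightarrow> epowr (ennreal x) a = ennreal (x powr a)"
  by (simp add: epowr_def)

lemma epowr_top [simp]: "epowr top a = top"
  by (simp add: epowr_def)

lemma epowr_zero [simp]: "epowr 0 a = 0"
  by (simp add: epowr_def)

lemma epowr_eq_0_iff [simp]: "epowr x a = 0 \<longleftrightarrow> x = 0"
  by (cases x) (auto simp: epowr_def)

lemma epowr_mono: "0 \<le> a \<Longrightarrow> x \<le> y \<Longrightarrow> epowr x a \<le> epowr y a"
  by (cases x; cases y) (auto simp: epowr_ennreal top_unique intro!: ennreal_leI powr_mono2)

lemma epowr_mult: "epowr (x * y) a = epowr x a * epowr y a"
  by (cases x; cases y)
     (auto simp: epowr_ennreal powr_mult ennreal_mult_top ennreal_top_mult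
           simp flip: ennreal_mult)

lemma divide_ennreal_pos: "0 < s \<Longrightarrow> x / ennreal s = x * ennreal (1 / s)"
  by (simp add: divide_ennreal_def inverse_ennreal inverse_eq_divide)

lemma borel_measurable_epowr [measurable]:
  assumes [measurable]: "f \<in> borel_measurable M"
  shows "(\<lambda>x. epowr (f x) a) \<in> borel_measurable M"
  unfolding epowr_def by measurable

lemma borel_measurable_antimono:
  fixes d :: "real \<Rightarrow> ennreal"
  assumes "antimono d"
  shows "d \<in> borel_measurable borel"
proof (rule borel_measurableI_greater)
  fix y
  define S where "S = {x. y < d x}"
  have down: "x' \<in> S" if "x \<in> S" "x' \<le> x" for x x'
    using that assms unfolding S_def by (auto dest: antimonoD intro: less_le_trans)
  have "is_interval S"
    unfolding is_interval_1 using down by blast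
  then have "S \<in> sets borel"
    by (rule real_interval_borel_measurable)
  then show "{x \<in> space borel. y < d x} \<in> sets borel"
    by (simp add: S_def)
qed

lemma borel_measurable_tail [measurable]:
  "(\<lambda>s::real. \<integral>\<^sup>+u\<in>{s..}. b u \<partial>lborel) \<in> borel_measurable borel"
  by (intro borel_measurable_antimono antimonoI nn_integral_mono mult_left_mono)
     (auto simp: indicator_def)

section \<open>A Hardy inequality for tail integrals\<close>

text \<open>
  Jensen's inequality up to a factor \<open>2\<^sup>g\<close>. For every \<open>c > 0\<close> the elementary bound
  \<open>h \<le> c + c\<^sup>1\<^sup>-\<^sup>g h\<^sup>g\<close> holds, since \<open>h > c\<close> forces \<open>(h / c)\<^sup>g\<^sup>-\<^sup>1 \<ge> 1\<close>. Integrating against \<open>k\<close> and choosing \<open>c\<close>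
  such that both terms on the right agree gives the result.
\<close>

lemma weak_Jensen_nn_integral:
  assumes [measurable]: "h \<in> borel_measurable M" "k \<in> borel_measurable M"
    and g: "1 \<le> g" and m: "0 < m" "(\<integral>\<^sup>+x. k x \<partial>M) = ennreal m"
  shows "epowr (\<integral>\<^sup>+x. h x * k x \<partial>M) g
    \<le> ennreal (2 powr g * m powr (g - 1)) * (\<integral>\<^sup>+x. epowr (h x) g * k x \<partial>M)"
proof (cases "\<integral>\<^sup>+x. epowr (h x) g * k x \<partial>M")
  case top
  then show ?thesis using m by (simp add: ennreal_mult_top)
next
  case (real j)
  show ?thesis
  proof (cases "j = 0")
    case True
    with real have "(\<integral>\<^sup>+x. epowr (h x) g * k x \<partial>M) = 0" by simp
    then have "AE x in M. epowr (h x) g * k x = 0"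
      by (intro nn_integral_0_iff_AE[THEN iffD1]) auto
    then have "AE x in M. h x * k x = 0" by simp
    then have "(\<integral>\<^sup>+x. h x * k x \<partial>M) = 0" by (subst nn_integral_0_iff_AE) auto
    then show ?thesis by simp
  next
    case False
    with real have j: "0 < j" by simp
    (* At this c the two terms c * m and c^(1-g) * j below coincide. *)
    define c where "c = (j / m) powr (1 / g)"
    have c: "0 < c" using j m by (simp add: c_def)
    have cg: "c powr g = j / m" using j m g by (simp add: c_def powr_powr)
    have pt: "h x \<le> ennreal c + ennreal (c powr (1 - g)) * epowr (h x) g" for x
    proof (cases "h x")
      case top
      then show ?thesis using c by (simp add: ennreal_mult_top)
    next
      case (real y)
      have "y \<le> c + c powr (1 - g) * y powr g"
      proof (cases "y \<le> c")
        case True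
        then show ?thesis by (simp add: add_increasing2)
      next
        case False
        then have "c powr (g - 1) \<le> y powr (g - 1)" using c g by (intro powr_mono2) auto
        then have "c powr (1 - g) * (c powr (g - 1)) * y \<le> c powr (1 - g) * (y powr (g - 1)) * y"
          using False c by (intro mult_right_mono mult_left_mono) auto
        moreover have "c powr (1 - g) * (c powr (g - 1)) = 1"
          using c by (simp flip: powr_add)
        moreover have "y powr (g - 1) * y = y powr g"
          using False c by (simp add: powr_diff)
        ultimately show ?thesis using c by (simp add: mult.assoc)
      qed
      then show ?thesis using real c
        by (simp add: epowr_ennreal flip: ennreal_mult ennreal_plus)
    qed
    have "(\<integral>\<^sup>+x. h x * k x \<partial>M)
        \<le> (\<integral>\<^sup>+x. ennreal c * k x + ennreal (c powr (1 - g)) * (epowr (h x) g * k x) \<partial>M)"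
      using pt by (intro nn_integral_mono)
        (metis distrib_right mult.assoc mult_right_mono zero_le)
    also have "\<dots> = ennreal c * ennreal m + ennreal (c powr (1 - g)) * ennreal j"
      by (subst nn_integral_add) (simp_all add: nn_integral_cmult m real)
    also have "\<dots> = ennreal (c * m + c powr (1 - g) * j)"
      using c m j by (simp flip: ennreal_mult ennreal_plus)
    also have "c powr (1 - g) * j = c * m"
      using c m j by (simp add: powr_diff cg)
    finally have "(\<integral>\<^sup>+x. h x * k x \<partial>M) \<le> ennreal (2 * (c * m))" by simp
    then have "epowr (\<integral>\<^sup>+x. h x * k x \<partial>M) g \<le> epowr (ennreal (2 * (c * m))) g"
      using g by (intro epowr_mono) auto
    also have "\<dots> = ennreal (2 powr g * (c powr g * m powr g))"
      using c m by (simp add: epowr_ennreal powr_mult)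
    also have "c powr g * m powr g = m powr (g - 1) * j"
      using m by (simp add: cg powr_diff)
    finally show ?thesis using real j m by (simp add: mult.assoc flip: ennreal_mult)
  qed
qed

lemma nn_integral_triangle_swap:
  fixes a b :: "real \<Rightarrow> ennreal"
  assumes [measurable]: "a \<in> borel_measurable borel" "b \<in> borel_measurable borel"
  shows "(\<integral>\<^sup>+s\<in>{0<..}. a s * (\<integral>\<^sup>+u\<in>{s..}. b u \<partial>lborel) \<partial>lborel)
    = (\<integral>\<^sup>+u\<in>{0<..}. b u * (\<integral>\<^sup>+s\<in>{0<..u}. a s \<partial>lborel) \<partial>lborel)"
proof -
  have "(\<integral>\<^sup>+s\<in>{0<..}. a s * (\<integral>\<^sup>+u\<in>{s..}. b u \<partial>lborel) \<partial>lborel)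
    = (\<integral>\<^sup>+s. \<integral>\<^sup>+u. (if 0 < s \<and> s \<le> u then a s * b u else 0) \<partial>lborel \<partial>lborel)"
  proof (intro nn_integral_cong)
    fix s :: real
    show "a s * (\<integral>\<^sup>+u\<in>{s..}. b u \<partial>lborel) * indicator {0<..} s =
      (\<integral>\<^sup>+u. (if 0 < s \<and> s \<le> u then a s * b u else 0) \<partial>lborel)"
    proof (cases "0 < s")
      case True
      then show ?thesis
        by (subst nn_integral_cmult[symmetric])
           (auto intro!: nn_integral_cong simp: indicator_def)
    qed simp
  qed
  also have "\<dots> = (\<integral>\<^sup>+u. \<integral>\<^sup>+s. (if 0 < s \<and> s \<le> u then a s * b u else 0) \<partial>lborel \<partial>lborel)"
    by (rule lborel_pair.Fubini') measurable
  also have "\<dots> = (\<integral>\<^sup>+u\<in>{0<..}. b u * (\<integral>\<^sup>+s\<in>{0<..u}. a s \<partial>lborel) \<partial>lborel)"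
  proof (intro nn_integral_cong)
    fix u :: real
    show "(\<integral>\<^sup>+s. (if 0 < s \<and> s \<le> u then a s * b u else 0) \<partial>lborel) =
      b u * (\<integral>\<^sup>+s\<in>{0<..u}. a s \<partial>lborel) * indicator {0<..} u"
    proof (cases "0 < u")
      case True
      then show ?thesis
        by (subst nn_integral_cmult[symmetric])
           (auto intro!: nn_integral_cong simp: indicator_def mult.commute)
    next
      case False
      then have "(\<lambda>s. (if 0 < s \<and> s \<le> u then a s * b u else 0)) = (\<lambda>s. 0)" by (intro ext) auto
      with False show ?thesis by simp
    qed
  qed
  finally show ?thesis .
qed

lemma nn_integral_powr_Ioc:
  assumes "0 < a" "0 \<le> u"
  shows "(\<integral>\<^sup>+s\<in>{0<..u}. ennreal (s powr (a - 1)) \<partial>lborel) = ennreal (u powr a / a)"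
proof -
  have "(\<integral>\<^sup>+s\<in>{0<..u}. ennreal (s powr (a - 1)) \<partial>lborel)
      = (\<integral>\<^sup>+s. ennreal (s powr (a - 1)) * indicator {0..u} s \<partial>lborel)"
    using AE_lborel_singleton[of 0] by (intro nn_integral_cong_AE) (auto simp: indicator_def)
  also have "\<dots> = ennreal (u powr (a - 1 + 1) / (a - 1 + 1))"
    using assms by (intro nn_integral_has_integral_lebesgue' has_integral_powr_from_0) auto
  finally show ?thesis by simp
qed

lemma nn_integral_powr_Ici:
  assumes "1 < r" "0 < s"
  shows "(\<integral>\<^sup>+u\<in>{s..}. ennreal (u powr - r) \<partial>lborel) = ennreal (s powr (1 - r) / (r - 1))"
proof -
  have "(\<integral>\<^sup>+u\<in>{s..}. ennreal (u powr - r) \<partial>lborel) = ennreal (- (s powr (- r + 1)) / (- r + 1))"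
    using assms by (intro nn_integral_has_integral_lebesgue' has_integral_powr_to_inf) auto
  also have "- (s powr (- r + 1)) / (- r + 1) = s powr (1 - r) / (r - 1)"
    using assms by (simp add: divide_simps algebra_simps)
  finally show ?thesis .
qed

text \<open>
  Writing \<open>d(u) = h(u) u\<^sup>-\<^sup>r\<close> with \<open>h(u) = u\<^sup>r d(u)\<close>, Jensen's inequality for the measure \<open>u\<^sup>-\<^sup>r du\<close> on
  \<open>[s, \<infinity>)\<close>, whose mass is \<open>s\<^sup>1\<^sup>-\<^sup>r / (r - 1)\<close>, moves the power \<open>g\<close> inside the tail integral. The powers of
  \<open>s\<close> then combine to \<open>s\<^sup>r\<^sup>-\<^sup>2\<close>, and exchanging the order of integration produces the second factor
  \<open>1 / (r - 1)\<close>.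
\<close>

lemma Hardy_tail_ge1:
  fixes d :: "real \<Rightarrow> ennreal"
  assumes [measurable]: "d \<in> borel_measurable borel" and r: "1 < r" and g: "1 \<le> g"
  shows "(\<integral>\<^sup>+s\<in>{0<..}. ennreal (s powr (r * g - 1)) *
            epowr ((\<integral>\<^sup>+u\<in>{s..}. d u \<partial>lborel) / ennreal s) g \<partial>lborel)
    \<le> ennreal ((2 / (r - 1)) powr g) *
        (\<integral>\<^sup>+s\<in>{0<..}. ennreal (s powr (r * g - 1)) * epowr (d s) g \<partial>lborel)"
proof -
  define h where "h = (\<lambda>u. ennreal (u powr r) * d u)"
  define b where "b = (\<lambda>u. epowr (h u) g * ennreal (u powr - r))"
  define C where "C = 2 powr g * (r - 1) powr (1 - g)"
  have C: "0 \<le> C" by (simp add: C_def)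
  have [measurable]: "h \<in> borel_measurable borel" unfolding h_def by measurable
  have [measurable]: "b \<in> borel_measurable borel" unfolding b_def by measurable
  have pt: "ennreal (s powr (r * g - 1)) * epowr ((\<integral>\<^sup>+u\<in>{s..}. d u \<partial>lborel) / ennreal s) g
      \<le> ennreal C * (ennreal (s powr ((r - 1) - 1)) * (\<integral>\<^sup>+u\<in>{s..}. b u \<partial>lborel))"
    if s: "0 < s" for s
  proof -
    define m where "m = s powr (1 - r) / (r - 1)"
    have m: "0 < m" using s r by (simp add: m_def)
    have "(\<integral>\<^sup>+u\<in>{s..}. d u \<partial>lborel)
        = (\<integral>\<^sup>+u. h u * (ennreal (u powr - r) * indicator {s..} u) \<partial>lborel)"
      using s by (intro nn_integral_cong)
        (auto simp: h_def indicator_def mult.commute mult.left_commute powr_minus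
              simp flip: ennreal_mult)
    also have "epowr \<dots> g \<le> ennreal (2 powr g * m powr (g - 1)) *
        (\<integral>\<^sup>+u. epowr (h u) g * (ennreal (u powr - r) * indicator {s..} u) \<partial>lborel)"
      using r s g m unfolding m_def
      by (intro weak_Jensen_nn_integral nn_integral_powr_Ici) auto
    also have "(\<integral>\<^sup>+u. epowr (h u) g * (ennreal (u powr - r) * indicator {s..} u) \<partial>lborel)
        = (\<integral>\<^sup>+u\<in>{s..}. b u \<partial>lborel)"
      by (simp add: b_def mult.assoc)
    finally have "epowr (\<integral>\<^sup>+u\<in>{s..}. d u \<partial>lborel) g
        \<le> ennreal (2 powr g * m powr (g - 1)) * (\<integral>\<^sup>+u\<in>{s..}. b u \<partial>lborel)" .
    then have "ennreal (s powr (r * g - 1)) * (epowr (\<integral>\<^sup>+u\<in>{s..}. d u \<partial>lborel) g * ennreal ((1 / s) powr g))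
        \<le> ennreal (s powr (r * g - 1)) *
          (ennreal (2 powr g * m powr (g - 1)) * (\<integral>\<^sup>+u\<in>{s..}. b u \<partial>lborel) * ennreal ((1 / s) powr g))"
      by (intro mult_left_mono mult_right_mono) auto
    also have "\<dots> = ennreal (s powr (r * g - 1) * (2 powr g * m powr (g - 1)) * (1 / s) powr g)
        * (\<integral>\<^sup>+u\<in>{s..}. b u \<partial>lborel)"
      by (simp add: ennreal_mult mult_ac)
    also have "s powr (r * g - 1) * (2 powr g * m powr (g - 1)) * (1 / s) powr g
        = C * s powr ((r - 1) - 1)"
    proof -
      have "m powr (g - 1) = s powr ((1 - r) * (g - 1)) * (r - 1) powr (1 - g)"
        using s r by (simp add: m_def powr_divide powr_powr divide_simps flip: powr_add)
      moreover have "(1 / s) powr g = s powr (- g)"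
        using s by (simp add: powr_divide powr_minus divide_simps)
      moreover have "s powr (r * g - 1) * s powr ((1 - r) * (g - 1)) * s powr (- g) = s powr ((r - 1) - 1)"
        by (simp add: algebra_simps flip: powr_add)
      ultimately show ?thesis by (simp add: C_def mult_ac)
    qed
    finally show ?thesis
      using s C by (simp add: divide_ennreal_pos epowr_mult epowr_ennreal ennreal_mult mult_ac)
  qed
  have "(\<integral>\<^sup>+s\<in>{0<..}. ennreal (s powr (r * g - 1)) *
            epowr ((\<integral>\<^sup>+u\<in>{s..}. d u \<partial>lborel) / ennreal s) g \<partial>lborel)
      \<le> (\<integral>\<^sup>+s. ennreal C * (ennreal (s powr ((r - 1) - 1)) * (\<integral>\<^sup>+u\<in>{s..}. b u \<partial>lborel)
            * indicator {0<..} s) \<partial>lborel)"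
    using pt by (intro nn_integral_mono) (auto simp: indicator_def)
  also have "\<dots> = ennreal C * (\<integral>\<^sup>+s\<in>{0<..}. ennreal (s powr ((r - 1) - 1)) *
      (\<integral>\<^sup>+u\<in>{s..}. b u \<partial>lborel) \<partial>lborel)"
    by (rule nn_integral_cmult) measurable
  also have "\<dots> = ennreal C * (\<integral>\<^sup>+u\<in>{0<..}. b u *
      (\<integral>\<^sup>+s\<in>{0<..u}. ennreal (s powr ((r - 1) - 1)) \<partial>lborel) \<partial>lborel)"
    by (subst nn_integral_triangle_swap) auto
  also have "\<dots> = ennreal C * (\<integral>\<^sup>+u. ennreal (1 / (r - 1)) *
      (ennreal (u powr (r * g - 1)) * epowr (d u) g * indicator {0<..} u) \<partial>lborel)"
  proof (rule arg_cong[where f = "(*) (ennreal C)"], rule nn_integral_cong)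
    fix u :: real
    show "b u * (\<integral>\<^sup>+s\<in>{0<..u}. ennreal (s powr ((r - 1) - 1)) \<partial>lborel) * indicator {0<..} u =
      ennreal (1 / (r - 1)) * (ennreal (u powr (r * g - 1)) * epowr (d u) g * indicator {0<..} u)"
    proof (cases "0 < u")
      case True
      have "u powr (r * g) * u powr - r * (u powr (r - 1) / (r - 1))
          = 1 / (r - 1) * u powr (r * g - 1)"
        by (simp add: algebra_simps flip: powr_add)
      from arg_cong[OF this, of ennreal]
      have e: "ennreal (u powr (r * g)) * ennreal (u powr - r) * ennreal (u powr (r - 1) / (r - 1))
          = ennreal (1 / (r - 1)) * ennreal (u powr (r * g - 1))"
        using r by (simp only: ennreal_mult powr_ge_zero mult_nonneg_nonneg divide_nonneg_nonneg
                      diff_ge_0_iff_ge less_imp_le zero_le_one)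
      have bu: "b u = epowr (d u) g * (ennreal (u powr (r * g)) * ennreal (u powr - r))"
        by (simp add: b_def h_def epowr_mult epowr_ennreal powr_powr mult_ac)
      have "b u * (\<integral>\<^sup>+s\<in>{0<..u}. ennreal (s powr ((r - 1) - 1)) \<partial>lborel)
          = b u * ennreal (u powr (r - 1) / (r - 1))"
        using r True by (subst nn_integral_powr_Ioc) auto
      also have "\<dots> = epowr (d u) g * (ennreal (1 / (r - 1)) * ennreal (u powr (r * g - 1)))"
        unfolding bu e[symmetric] by (simp only: mult.assoc)
      finally show ?thesis by (simp only: mult_ac)
    qed simp
  qed
  also have "\<dots> = ennreal (C * (1 / (r - 1))) *
      (\<integral>\<^sup>+u\<in>{0<..}. ennreal (u powr (r * g - 1)) * epowr (d u) g \<partial>lborel)"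
    using r C by (subst nn_integral_cmult) (simp_all add: ennreal_mult mult.assoc del: times_divide_eq_right)
  also have "C * (1 / (r - 1)) = (2 / (r - 1)) powr g"
    using r by (simp add: C_def powr_divide powr_diff)
  finally show ?thesis .
qed

text \<open>
  For \<open>g \<le> 1\<close> Jensen's inequality points the wrong way and monotonicity of \<open>d\<close> replaces it. Let \<open>I\<close> be
  the expression in parentheses on the right. Since \<open>d\<close> decreases, \<open>x\<^sup>g d(x)\<^sup>g \<le> I\<close> for all \<open>x \<ge> s\<close>, so
  \<open>d = d\<^sup>g d\<^sup>1\<^sup>-\<^sup>g\<close> is at most \<open>x\<^sup>g\<^sup>-\<^sup>1 d(x)\<^sup>g\<close> times the power \<open>(1 - g) / g\<close> of \<open>I\<close>. Integrating this bound
  gives \<open>I\<^sup>1\<^sup>/\<^sup>g / g\<close>.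
\<close>

lemma tail_powr_le1:
  fixes d :: "real \<Rightarrow> ennreal"
  assumes d: "antimono d" and g: "0 < g" "g \<le> 1" and s: "0 < s"
  shows "epowr (\<integral>\<^sup>+u\<in>{s..}. d u \<partial>lborel) g
    \<le> ennreal (g powr - g) * (ennreal (s powr g) * epowr (d s) g +
        ennreal g * (\<integral>\<^sup>+u\<in>{s..}. ennreal (u powr (g - 1)) * epowr (d u) g \<partial>lborel))"
proof -
  have [measurable]: "d \<in> borel_measurable borel" by (rule borel_measurable_antimono[OF d])
  define I where "I = ennreal (s powr g) * epowr (d s) g +
        ennreal g * (\<integral>\<^sup>+u\<in>{s..}. ennreal (u powr (g - 1)) * epowr (d u) g \<partial>lborel)"
  have le_I: "ennreal (x powr g) * epowr (d x) g \<le> I" if x: "s \<le> x" for x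
  proof -
    have *: "ennreal (y powr g) * c
        = ennreal g * (\<integral>\<^sup>+u. ennreal (u powr (g - 1)) * c * indicator {0<..y} u \<partial>lborel)"
      if "0 < y" for y c
    proof -
      have "(\<integral>\<^sup>+u. ennreal (u powr (g - 1)) * c * indicator {0<..y} u \<partial>lborel)
          = (\<integral>\<^sup>+u\<in>{0<..y}. ennreal (u powr (g - 1)) \<partial>lborel) * c"
        by (subst nn_integral_multc[symmetric]) (auto simp: mult_ac)
      also have "\<dots> = ennreal (y powr g / g) * c"
        using that g by (simp add: nn_integral_powr_Ioc)
      finally show ?thesis using g by (simp flip: mult.assoc ennreal_mult)
    qed
    have "ennreal (x powr g) * epowr (d x) g
        = ennreal g * (\<integral>\<^sup>+u. ennreal (u powr (g - 1)) * epowr (d x) g * indicator {0<..x} u \<partial>lborel)"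
      using s x by (intro *) auto
    also have "\<dots> \<le> ennreal g * (\<integral>\<^sup>+u. ennreal (u powr (g - 1)) * epowr (d s) g * indicator {0<..s} u
          + ennreal (u powr (g - 1)) * epowr (d u) g * indicator {s..} u \<partial>lborel)"
    proof (intro mult_left_mono nn_integral_mono)
      fix u
      have le: "ennreal (u powr (g - 1)) * epowr (d x) g \<le> ennreal (u powr (g - 1)) * epowr (d y) g"
        if "y \<le> x" for y
        using that d g by (intro mult_left_mono epowr_mono) (auto dest: antimonoD)
      show "ennreal (u powr (g - 1)) * epowr (d x) g * indicator {0<..x} u
        \<le> ennreal (u powr (g - 1)) * epowr (d s) g * indicator {0<..s} u
          + ennreal (u powr (g - 1)) * epowr (d u) g * indicator {s..} u"
        using le[of s] le[of u] x
        by (cases "u \<le> s") (auto simp: indicator_def intro!: add_increasing2)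
    qed auto
    also have "\<dots> = I"
      using s by (subst nn_integral_add) (auto simp: I_def distrib_left *)
    finally show ?thesis .
  qed
  show ?thesis
  proof (cases I)
    case top
    with g show ?thesis by (simp add: I_def[symmetric] ennreal_mult_top)
  next
    case (real i)
    have pt: "d x \<le> ennreal (i powr ((1 - g) / g)) * (ennreal (x powr (g - 1)) * epowr (d x) g)"
      if x: "s \<le> x" for x
    proof (cases "d x")
      case top
      with le_I[OF x] real s x show ?thesis by (simp add: ennreal_mult_top top_unique)
    next
      case (real y)
      have "ennreal (x powr g * y powr g) \<le> ennreal i"
        using le_I[OF x] \<open>I = ennreal i\<close> real by (simp add: epowr_ennreal ennreal_mult)
      then have "x powr g * y powr g \<le> i" using \<open>0 \<le> i\<close> by simp
      then have "(x * y) powr g \<le> i" using s x real by (simp add: powr_mult)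
      then have "((x * y) powr g) powr ((1 - g) / g) \<le> i powr ((1 - g) / g)"
        using g by (intro powr_mono2) auto
      then have xy: "(x * y) powr (1 - g) \<le> i powr ((1 - g) / g)"
        using g by (simp add: powr_powr)
      have "y \<le> i powr ((1 - g) / g) * (x powr (g - 1) * y powr g)"
      proof (cases "y = 0")
        case False
        with real have y: "0 < y" by simp
        have "(x * y) powr (1 - g) * (x powr (g - 1) * y powr g)
            = (x powr (1 - g) * x powr (g - 1)) * (y powr (1 - g) * y powr g)"
          using s x y by (simp add: powr_mult mult_ac)
        also have "\<dots> = y" using s x y by (simp flip: powr_add)
        finally show ?thesis using xy
          by (metis mult_right_mono mult_nonneg_nonneg powr_ge_zero)
      qed (use g in simp)
      then show ?thesis using real by (simp add: epowr_ennreal flip: ennreal_mult)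
    qed
    have "ennreal g * (\<integral>\<^sup>+u\<in>{s..}. d u \<partial>lborel)
        \<le> ennreal g * (\<integral>\<^sup>+u. ennreal (i powr ((1 - g) / g)) *
            (ennreal (u powr (g - 1)) * epowr (d u) g * indicator {s..} u) \<partial>lborel)"
      using pt by (intro mult_left_mono nn_integral_mono) (auto simp: indicator_def)
    also have "\<dots> = ennreal (i powr ((1 - g) / g)) * (ennreal g *
            (\<integral>\<^sup>+u\<in>{s..}. ennreal (u powr (g - 1)) * epowr (d u) g \<partial>lborel))"
      by (subst nn_integral_cmult) (auto simp: mult_ac)
    also have "\<dots> \<le> ennreal (i powr ((1 - g) / g)) * I"
      by (intro mult_left_mono) (auto simp: I_def add_increasing)
    also have "\<dots> = ennreal (i powr (1 / g))"
      using real g by (cases "i = 0") (auto simp: diff_divide_distrib powr_diff simp flip: ennreal_mult)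
    finally have "ennreal g * (\<integral>\<^sup>+u\<in>{s..}. d u \<partial>lborel) \<le> ennreal (i powr (1 / g))" .
    then have "epowr (ennreal g * (\<integral>\<^sup>+u\<in>{s..}. d u \<partial>lborel)) g \<le> epowr (ennreal (i powr (1 / g))) g"
      using g by (intro epowr_mono) auto
    then have *: "ennreal (g powr g) * epowr (\<integral>\<^sup>+u\<in>{s..}. d u \<partial>lborel) g \<le> I"
      using g real by (simp add: epowr_mult epowr_ennreal powr_powr)
    have "epowr (\<integral>\<^sup>+u\<in>{s..}. d u \<partial>lborel) g
        = ennreal (g powr - g) * (ennreal (g powr g) * epowr (\<integral>\<^sup>+u\<in>{s..}. d u \<partial>lborel) g)"
      using g by (simp flip: mult.assoc ennreal_mult powr_add)
    also have "\<dots> \<le> ennreal (g powr - g) * I" by (intro mult_left_mono *) auto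
    finally show ?thesis by (simp add: I_def)
  qed
qed

text \<open>
  The first summand of the pointwise bound reproduces the right-hand integral; exchanging the order of
  integration in the second gives \<open>1 / (r - 1)\<close> times it, and \<open>1 + 1 / (r - 1) = r / (r - 1)\<close>.
\<close>

lemma Hardy_tail_le1:
  fixes d :: "real \<Rightarrow> ennreal"
  assumes d: "antimono d" and r: "1 < r" and g: "0 < g" "g \<le> 1"
  shows "(\<integral>\<^sup>+s\<in>{0<..}. ennreal (s powr (r * g - 1)) *
            epowr ((\<integral>\<^sup>+u\<in>{s..}. d u \<partial>lborel) / ennreal s) g \<partial>lborel)
    \<le> ennreal (g powr - g * (r / (r - 1))) *
        (\<integral>\<^sup>+s\<in>{0<..}. ennreal (s powr (r * g - 1)) * epowr (d s) g \<partial>lborel)"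
proof -
  have [measurable]: "d \<in> borel_measurable borel" by (rule borel_measurable_antimono[OF d])
  define b where "b = (\<lambda>u. ennreal (u powr (g - 1)) * epowr (d u) g)"
  define J where "J = (\<integral>\<^sup>+s\<in>{0<..}. ennreal (s powr (r * g - 1)) * epowr (d s) g \<partial>lborel)"
  have [measurable]: "b \<in> borel_measurable borel" unfolding b_def by measurable
  have pt: "ennreal (s powr (r * g - 1)) * epowr ((\<integral>\<^sup>+u\<in>{s..}. d u \<partial>lborel) / ennreal s) g
      \<le> ennreal (g powr - g) * (ennreal (s powr (r * g - 1)) * epowr (d s) g +
          ennreal g * (ennreal (s powr (g * (r - 1) - 1)) * (\<integral>\<^sup>+u\<in>{s..}. b u \<partial>lborel)))"
    if s: "0 < s" for s
  proof -
    have e: "ennreal (s powr (r * g - 1)) * ennreal ((1 / s) powr g) = ennreal (s powr (g * (r - 1) - 1))"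
    proof -
      have "(1 / s) powr g = s powr - g" using s by (simp add: powr_divide powr_minus divide_simps)
      then show ?thesis by (simp add: algebra_simps flip: ennreal_mult powr_add)
    qed
    have e': "ennreal (s powr (g * (r - 1) - 1)) * ennreal (s powr g) = ennreal (s powr (r * g - 1))"
      using s by (simp add: algebra_simps flip: ennreal_mult powr_add)
    have "ennreal (s powr (r * g - 1)) * epowr ((\<integral>\<^sup>+u\<in>{s..}. d u \<partial>lborel) / ennreal s) g
        = ennreal (s powr (g * (r - 1) - 1)) * epowr (\<integral>\<^sup>+u\<in>{s..}. d u \<partial>lborel) g"
      unfolding e[symmetric] using s by (simp add: divide_ennreal_pos epowr_mult epowr_ennreal mult_ac)
    also have "\<dots> \<le> ennreal (s powr (g * (r - 1) - 1)) * (ennreal (g powr - g) *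
        (ennreal (s powr g) * epowr (d s) g + ennreal g * (\<integral>\<^sup>+u\<in>{s..}. b u \<partial>lborel)))"
      unfolding b_def using d g s by (intro mult_left_mono tail_powr_le1) auto
    also have "\<dots> = ennreal (g powr - g) *
        (ennreal (s powr (g * (r - 1) - 1)) * ennreal (s powr g) * epowr (d s) g +
          ennreal g * (ennreal (s powr (g * (r - 1) - 1)) * (\<integral>\<^sup>+u\<in>{s..}. b u \<partial>lborel)))"
      by (simp add: distrib_left mult_ac)
    finally show ?thesis unfolding e' .
  qed
  have swap: "ennreal g * (\<integral>\<^sup>+s\<in>{0<..}. ennreal (s powr (g * (r - 1) - 1)) *
      (\<integral>\<^sup>+u\<in>{s..}. b u \<partial>lborel) \<partial>lborel) = ennreal (1 / (r - 1)) * J"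
  proof -
    have "ennreal g * (\<integral>\<^sup>+s\<in>{0<..}. ennreal (s powr (g * (r - 1) - 1)) *
        (\<integral>\<^sup>+u\<in>{s..}. b u \<partial>lborel) \<partial>lborel)
      = ennreal g * (\<integral>\<^sup>+u\<in>{0<..}. b u *
        (\<integral>\<^sup>+s\<in>{0<..u}. ennreal (s powr (g * (r - 1) - 1)) \<partial>lborel) \<partial>lborel)"
      by (subst nn_integral_triangle_swap) auto
    also have "\<dots> = ennreal g * (\<integral>\<^sup>+u. ennreal (1 / (g * (r - 1))) *
        (ennreal (u powr (r * g - 1)) * epowr (d u) g * indicator {0<..} u) \<partial>lborel)"
    proof (rule arg_cong[where f = "(*) (ennreal g)"], rule nn_integral_cong)
      fix u :: real
      have "u powr (g - 1) * (u powr (g * (r - 1)) / (g * (r - 1)))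
          = 1 / (g * (r - 1)) * u powr (r * g - 1)"
        by (simp add: algebra_simps flip: powr_add)
      from arg_cong[OF this, of ennreal]
      have e: "ennreal (u powr (g - 1)) * ennreal (u powr (g * (r - 1)) / (g * (r - 1)))
          = ennreal (1 / (g * (r - 1))) * ennreal (u powr (r * g - 1))"
        using r g by (simp only: ennreal_mult powr_ge_zero mult_nonneg_nonneg divide_nonneg_nonneg
                      diff_ge_0_iff_ge less_imp_le zero_le_one)
      show "b u * (\<integral>\<^sup>+s\<in>{0<..u}. ennreal (s powr (g * (r - 1) - 1)) \<partial>lborel) * indicator {0<..} u =
        ennreal (1 / (g * (r - 1))) * (ennreal (u powr (r * g - 1)) * epowr (d u) g * indicator {0<..} u)"
      proof (cases "0 < u")
        case True
        have "b u * (\<integral>\<^sup>+s\<in>{0<..u}. ennreal (s powr (g * (r - 1) - 1)) \<partial>lborel)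
            = b u * ennreal (u powr (g * (r - 1)) / (g * (r - 1)))"
          using r g True by (subst nn_integral_powr_Ioc) auto
        also have "\<dots> = epowr (d u) g * (ennreal (u powr (g - 1)) * ennreal (u powr (g * (r - 1)) / (g * (r - 1))))"
          unfolding b_def by (simp only: mult_ac)
        also note e
        finally show ?thesis by (simp only: mult_ac)
      qed simp
    qed
    also have "\<dots> = ennreal (g * (1 / (g * (r - 1)))) * J"
      using r g by (subst nn_integral_cmult)
        (simp_all add: J_def ennreal_mult mult.assoc del: times_divide_eq_right)
    finally show ?thesis using g by simp
  qed
  have "(\<integral>\<^sup>+s\<in>{0<..}. ennreal (s powr (r * g - 1)) *
            epowr ((\<integral>\<^sup>+u\<in>{s..}. d u \<partial>lborel) / ennreal s) g \<partial>lborel)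
    \<le> (\<integral>\<^sup>+s. ennreal (g powr - g) * (ennreal (s powr (r * g - 1)) * epowr (d s) g * indicator {0<..} s +
          ennreal g * (ennreal (s powr (g * (r - 1) - 1)) * (\<integral>\<^sup>+u\<in>{s..}. b u \<partial>lborel)
            * indicator {0<..} s)) \<partial>lborel)"
    using pt by (intro nn_integral_mono) (auto simp: indicator_def)
  also have "\<dots> = ennreal (g powr - g) * (J + ennreal g *
      (\<integral>\<^sup>+s\<in>{0<..}. ennreal (s powr (g * (r - 1) - 1)) * (\<integral>\<^sup>+u\<in>{s..}. b u \<partial>lborel) \<partial>lborel))"
    by (simp add: nn_integral_cmult nn_integral_add J_def)
  also have "\<dots> = ennreal (g powr - g) * (ennreal (1 + 1 / (r - 1)) * J)"
    using r unfolding swap by (subst ennreal_plus) (auto simp: distrib_right)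
  also have "\<dots> = ennreal (g powr - g * (1 + 1 / (r - 1))) * J"
    using r by (simp add: ennreal_mult mult.assoc)
  also have "1 + 1 / (r - 1) = r / (r - 1)" using r by (simp add: divide_simps)
  finally show ?thesis unfolding J_def .
qed

text \<open>
  The loss \<open>g\<^sup>-\<^sup>g\<close> in the range \<open>g \<le> 1\<close> is bounded uniformly in \<open>g\<close>, so the final constant does not depend
  on the exponents.
\<close>

lemma powr_self_le_exp1: "0 < g \<Longrightarrow> g powr - g \<le> exp (1::real)"
proof -
  assume g: "0 < g"
  have "ln (1 / g) \<le> 1 / g - 1" using g by (intro ln_le_minus_one) auto
  then have "g * ln (1 / g) \<le> g * (1 / g - 1)" using g by (intro mult_left_mono) auto
  also have "\<dots> \<le> 1" using g by (simp add: right_diff_distrib)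
  finally show ?thesis using g by (simp add: powr_def ln_div)
qed

text \<open>
  The two regimes \<open>t \<ge> r\<close> and \<open>t < r\<close> of the Lorentz exponents, with \<open>g = t / r\<close>. The factor \<open>3\<^sup>t\<close> becomes
  an absolute constant after taking \<open>t\<close>-th roots, and \<open>p = r / (r - 1)\<close> is the exponent conjugate to \<open>r\<close>.
\<close>

lemma Hardy_tail:
  fixes d :: "real \<Rightarrow> ennreal"
  assumes d: "antimono d" and r: "1 < r" and t: "1 < t"
  shows "(\<integral>\<^sup>+s\<in>{0<..}. ennreal (s powr (t - 1)) *
            epowr ((\<integral>\<^sup>+u\<in>{s..}. d u \<partial>lborel) / ennreal s) (t / r) \<partial>lborel)
    \<le> ennreal (3 powr t * (r / (r - 1)) powr (t / min r t)) *
        (\<integral>\<^sup>+s\<in>{0<..}. ennreal (s powr (t - 1)) * epowr (d s) (t / r) \<partial>lborel)"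
proof -
  have t_eq: "t = r * (t / r)" using r by simp
  have p: "0 < r / (r - 1)" using r by simp
  show ?thesis
  proof (cases "r \<le> t")
    case True
    have "(2 / (r - 1)) powr (t / r) \<le> (3 * (r / (r - 1))) powr (t / r)"
      using r t by (intro powr_mono2) (auto intro!: divide_right_mono)
    also have "\<dots> = 3 powr (t / r) * (r / (r - 1)) powr (t / r)"
      using r by (simp add: powr_mult powr_divide)
    also have "\<dots> \<le> 3 powr t * (r / (r - 1)) powr (t / min r t)"
      using r t True by (intro mult_mono powr_mono) (auto simp: field_simps)
    finally have c: "(2 / (r - 1)) powr (t / r) \<le> 3 powr t * (r / (r - 1)) powr (t / min r t)" .
    have [measurable]: "d \<in> borel_measurable borel" by (rule borel_measurable_antimono[OF d])
    show ?thesis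
      using Hardy_tail_ge1[of d r "t / r"] r t True c unfolding t_eq[symmetric]
      by (auto elim!: order.trans intro!: mult_right_mono ennreal_leI)
  next
    case False
    have "(t / r) powr - (t / r) * (r / (r - 1)) \<le> exp 1 * (r / (r - 1))"
      using r t by (intro mult_right_mono powr_self_le_exp1) auto
    also have "\<dots> \<le> 3 powr t * (r / (r - 1)) powr (t / min r t)"
    proof (intro mult_mono)
      have "exp 1 \<le> (3::real) powr 1" using exp_le by simp
      also have "\<dots> \<le> 3 powr t" using t by (intro powr_mono) auto
      finally show "exp 1 \<le> 3 powr t" .
    qed (use r t False p in auto)
    finally have c: "(t / r) powr - (t / r) * (r / (r - 1))
      \<le> 3 powr t * (r / (r - 1)) powr (t / min r t)" .
    show ?thesis
      using Hardy_tail_le1[of d r "t / r"] d r t False c unfolding t_eq[symmetric]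
      by (auto elim!: order.trans intro!: mult_right_mono ennreal_leI)
  qed
qed

section \<open>Comparison of measures through Vitali coverings by cubes\<close>

text \<open>
  Cubes are parametrised by centre and half side length, so that dilation is a change of the second
  argument and comparison with Euclidean balls is immediate.
\<close>

definition ccube :: "real ^ 'n \<Rightarrow> real \<Rightarrow> (real ^ 'n) set" where
  "ccube a h = cbox (a - (\<chi> i. h)) (a + (\<chi> i. h))"

definition ocube :: "real ^ 'n \<Rightarrow> real \<Rightarrow> (real ^ 'n) set" where
  "ocube a h = box (a - (\<chi> i. h)) (a + (\<chi> i. h))"

lemma mem_ccube: "x \<in> ccube a h \<longleftrightarrow> (\<forall>i. \<bar>x $ i - a $ i\<bar> \<le> h)"
  by (auto simp: ccube_def mem_box_cart abs_le_iff algebra_simps)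

lemma mem_ocube: "x \<in> ocube a h \<longleftrightarrow> (\<forall>i. \<bar>x $ i - a $ i\<bar> < h)"
  by (auto simp: ocube_def mem_box_cart abs_less_iff algebra_simps)

lemma open_ocube: "open (ocube a h)"
  by (simp add: ocube_def open_box)

lemma ocube_subset_ccube: "ocube a h \<subseteq> ccube a h"
  by (auto simp: mem_ocube mem_ccube less_imp_le)

lemma ccube_mono: "h \<le> h' \<Longrightarrow> ccube a h \<subseteq> ccube a h'"
  by (auto simp: mem_ccube) (meson order.trans)

lemma sets_ccube [measurable]: "ccube a h \<in> sets lebesgue"
  by (simp add: ccube_def)

lemma cubes_eq_ccube: "cubes = {ccube a h | a h. 0 < h}"
proof (intro set_eqI iffI)
  fix Q :: "(real ^ 'n) set"
  assume "Q \<in> cubes"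
  then obtain a h where Q: "Q = cbox a (a + (\<chi> i. h))" "0 < h" by (auto simp: cubes_def)
  have "Q = ccube (a + (\<chi> i. h / 2)) (h / 2)"
    unfolding Q ccube_def by (intro arg_cong2[where f = cbox]) (auto simp: vec_eq_iff)
  with Q show "Q \<in> {ccube a h | a h. 0 < h}" by (intro CollectI exI[of _ "h / 2"] exI) auto
next
  fix Q :: "(real ^ 'n) set"
  assume "Q \<in> {ccube a h | a h. 0 < h}"
  then obtain a h where Q: "Q = ccube a h" "0 < h" by auto
  have "Q = cbox (a - (\<chi> i. h)) ((a - (\<chi> i. h)) + (\<chi> i. 2 * h))"
    unfolding Q ccube_def by (intro arg_cong2[where f = cbox]) (auto simp: vec_eq_iff)
  with Q show "Q \<in> cubes" unfolding cubes_def
    by (intro CollectI exI[of _ "2 * h"] exI) auto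
qed

lemma emeasure_ccube:
  assumes "0 \<le> h"
  shows "emeasure lebesgue (ccube a h :: (real ^ 'n) set) = ennreal ((2 * h) ^ CARD('n))"
proof -
  have "a \<in> ccube a h" using assms by (simp add: mem_ccube)
  then have "measure lborel (ccube a h) = (2 * h) ^ CARD('n)"
    unfolding ccube_def by (subst content_cbox_cart) auto
  then show ?thesis
    by (simp add: ccube_def emeasure_eq_ennreal_measure emeasure_lborel_cbox_eq)
qed

lemma ccube_subset_cball: "ccube a h \<subseteq> cball (a :: real ^ 'n) (real CARD('n) * h)"
proof
  fix x assume x: "x \<in> ccube a h"
  have "norm (x - a) \<le> (\<Sum>i\<in>UNIV. \<bar>(x - a) $ i\<bar>)" by (rule norm_le_l1_cart)
  also have "\<dots> \<le> real CARD('n) * h"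
    using x by (intro sum_bounded_above) (auto simp: mem_ccube)
  finally show "x \<in> cball a (real CARD('n) * h)" by (simp add: dist_norm norm_minus_commute)
qed

lemma cball_subset_ccube: "cball (a :: real ^ 'n) R \<subseteq> ccube a R"
proof
  fix x assume "x \<in> cball a R"
  then have "norm (x - a) \<le> R" by (simp add: dist_norm norm_minus_commute)
  then show "x \<in> ccube a R"
    using component_le_norm_cart[of "x - a"] by (auto simp: mem_ccube intro: order.trans)
qed

lemma emeasure_UN_le_count_space:
  assumes "countable I" and [measurable]: "\<And>i. i \<in> I \<Longrightarrow> X i \<in> sets M"
  shows "emeasure M (\<Union>i\<in>I. X i) \<le> (\<integral>\<^sup>+i. emeasure M (X i) \<partial>count_space I)"
proof -
  have "(\<Union>i\<in>I. X i) \<in> sets M" using assms by (intro sets.countable_UN') auto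
  then have "emeasure M (\<Union>i\<in>I. X i) = (\<integral>\<^sup>+x. indicator (\<Union>i\<in>I. X i) x \<partial>M)" by simp
  also have "\<dots> \<le> (\<integral>\<^sup>+x. \<integral>\<^sup>+i. indicator (X i) x \<partial>count_space I \<partial>M)"
  proof (intro nn_integral_mono)
    fix x
    show "indicator (\<Union>i\<in>I. X i) x \<le> (\<integral>\<^sup>+i. indicator (X i) x \<partial>count_space I :: ennreal)"
    proof (cases "x \<in> (\<Union>i\<in>I. X i)")
      case True
      then obtain i where "i \<in> I" "x \<in> X i" by auto
      then show ?thesis using nn_integral_ge_point[of i I "\<lambda>i. indicator (X i) x"] True by simp
    qed simp
  qed
  also have "\<dots> = (\<integral>\<^sup>+i. \<integral>\<^sup>+x. indicator (X i) x \<partial>M \<partial>count_space I)"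
    using assms by (intro nn_integral_count_space_nn_integral) auto
  also have "\<dots> = (\<integral>\<^sup>+i. emeasure M (X i) \<partial>count_space I)"
    using assms by (intro nn_integral_cong) auto
  finally show ?thesis .
qed

text \<open>
  Vitali's lemma is applied to the Euclidean balls of radius \<open>n h\<close>, which contain the cubes of half
  side \<open>h\<close>; their fivefold enlargements lie in the cubes of half side \<open>5 n h\<close>. Disjoint balls
  contain disjoint cubes.
\<close>

lemma Vitali_cubes_bounded:
  fixes K :: "((real ^ 'n) \<times> real) set"
  assumes sM: "sets M = sets lebesgue" and sN: "sets N = sets lebesgue"
    and h: "\<And>a h. (a, h) \<in> K \<Longrightarrow> 0 < h \<and> h \<le> R"
    and MN: "\<And>a h. (a, h) \<in> K \<Longrightarrow> emeasure M (ccube a (5 * real CARD('n) * h)) \<le> emeasure N (ccube a h)"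
  shows "emeasure M (\<Union>(a, h)\<in>K. ocube a h) \<le> emeasure N UNIV"
proof -
  define n where "n = real CARD('n)"
  have n: "0 < n" by (simp add: n_def)
  have cov: "(\<Union>(a, h)\<in>K. ocube a h) \<subseteq> (\<Union>i\<in>K. cball (fst i) (n * snd i))"
  proof (clarify, intro UN_I)
    fix a :: "real ^ 'n" and h x assume "x \<in> ocube a h"
    then show "x \<in> cball (fst (a, h)) (n * snd (a, h))"
      using ocube_subset_ccube[of a h] ccube_subset_cball[of a h] by (auto simp: n_def)
  qed
  obtain C where C: "countable C" "C \<subseteq> K"
    and disj: "pairwise (\<lambda>i j. disjnt (cball (fst i) (n * snd i)) (cball (fst j) (n * snd j))) C"
    and sub: "(\<Union>(a, h)\<in>K. ocube a h) \<subseteq> (\<Union>i\<in>C. cball (fst i) (5 * (n * snd i)))"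
  proof (rule Vitali_covering_lemma_cballs[OF cov, of "n * R"])
    show "0 < n * snd i \<and> n * snd i \<le> n * R" if "i \<in> K" for i
      using h[of "fst i" "snd i"] that n by simp
  qed (use that in blast)
  have disj': "disjoint_family_on (\<lambda>i. ccube (fst i) (snd i)) C"
    unfolding disjoint_family_on_def
  proof (intro ballI impI)
    fix i j assume "i \<in> C" "j \<in> C" "i \<noteq> j"
    then have "cball (fst i) (n * snd i) \<inter> cball (fst j) (n * snd j) = {}"
      using disj by (simp add: pairwise_def disjnt_def)
    then show "ccube (fst i) (snd i) \<inter> ccube (fst j) (snd j) = {}"
      using ccube_subset_cball[of "fst i" "snd i"] ccube_subset_cball[of "fst j" "snd j"]
      by (auto simp: n_def)
  qed
  have "emeasure M (\<Union>(a, h)\<in>K. ocube a h) \<le> emeasure M (\<Union>i\<in>C. ccube (fst i) (5 * n * snd i))"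
  proof (intro emeasure_mono)
    have "cball (fst i) (5 * (n * snd i)) \<subseteq> ccube (fst i) (5 * n * snd i)" for i
      using cball_subset_ccube[of "fst i" "5 * (n * snd i)"] by (simp add: mult.assoc)
    then show "(\<Union>(a, h)\<in>K. ocube a h) \<subseteq> (\<Union>i\<in>C. ccube (fst i) (5 * n * snd i))"
      using sub by blast
    show "(\<Union>i\<in>C. ccube (fst i) (5 * n * snd i)) \<in> sets M"
      using C by (intro sets.countable_UN') (auto simp: sM)
  qed
  also have "\<dots> \<le> (\<integral>\<^sup>+i. emeasure M (ccube (fst i) (5 * n * snd i)) \<partial>count_space C)"
    using C by (intro emeasure_UN_le_count_space) (auto simp: sM)
  also have "\<dots> \<le> (\<integral>\<^sup>+i. emeasure N (ccube (fst i) (snd i)) \<partial>count_space C)"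
    using MN C by (intro nn_integral_mono) (auto simp: n_def)
  also have "\<dots> = emeasure N (\<Union>i\<in>C. ccube (fst i) (snd i))"
    using disj' C by (intro emeasure_UN_countable[symmetric]) (auto simp: sN)
  also have "\<dots> \<le> emeasure N UNIV"
    by (intro emeasure_mono) (auto simp: sN)
  finally show ?thesis .
qed

text \<open>
  The bound on the size of the cubes is removed by monotone convergence. Open cubes make the unions
  open, hence measurable for an arbitrary index set.
\<close>

lemma Vitali_cubes:
  fixes K :: "((real ^ 'n) \<times> real) set"
  assumes sM: "sets M = sets lebesgue" and sN: "sets N = sets lebesgue"
    and h: "\<And>a h. (a, h) \<in> K \<Longrightarrow> 0 < h"
    and MN: "\<And>a h. (a, h) \<in> K \<Longrightarrow> emeasure M (ccube a (5 * real CARD('n) * h)) \<le> emeasure N (ccube a h)"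
  shows "emeasure M (\<Union>(a, h)\<in>K. ocube a h) \<le> emeasure N UNIV"
proof -
  define U where "U = (\<lambda>R. \<Union>(a, h)\<in>{(a, h)\<in>K. h \<le> real R}. ocube a h)"
  have U: "(\<Union>(a, h)\<in>K. ocube a h) = (\<Union>R. U R)"
  proof
    show "(\<Union>(a, h)\<in>K. ocube a h) \<subseteq> (\<Union>R. U R)"
    proof clarify
      fix a h x assume "(a, h) \<in> K" "x \<in> ocube a h"
      moreover obtain R where "h \<le> real R" using real_arch_simple by blast
      ultimately show "x \<in> (\<Union>R. U R)" unfolding U_def by blast
    qed
  qed (auto simp: U_def)
  have "range U \<subseteq> sets M"
    by (auto simp: sM U_def intro!: lborelD open_UN open_ocube borel_open)
  moreover have "incseq U"
  proof (intro incseq_SucI)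
    fix R show "U R \<subseteq> U (Suc R)" unfolding U_def by (intro UN_mono) auto
  qed
  ultimately have "emeasure M (\<Union>R. U R) = (SUP R. emeasure M (U R))"
    by (intro SUP_emeasure_incseq[symmetric])
  also have "\<dots> \<le> emeasure N UNIV"
    unfolding U_def using h MN by (intro SUP_least Vitali_cubes_bounded sM sN) auto
  finally show ?thesis by (simp add: U)
qed

section \<open>Weak type estimate for the maximal operator\<close>

lemma maximal_ge_ccube:
  assumes "0 < h" "x \<in> ccube a h"
  shows "(\<integral>\<^sup>+y\<in>ccube a h. ennreal \<bar>f y\<bar> \<partial>lebesgue) / emeasure lebesgue (ccube a h) \<le> maximal f x"
  unfolding maximal_def using assms by (intro SUP_upper) (auto simp: cubes_eq_ccube)

text \<open>
  The strict inequality survives a slight enlargement of the cube, which moves the point into the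
  interior.
\<close>

lemma maximal_gtE:
  fixes x :: "real ^ 'n"
  assumes "ennreal c < maximal f x" "0 \<le> c"
  obtains a h where "0 < h" "x \<in> ocube a h"
    "ennreal (c * (2 * h) ^ CARD('n)) < (\<integral>\<^sup>+y\<in>ccube a h. ennreal \<bar>f y\<bar> \<partial>lebesgue)"
proof -
  obtain a k where k: "0 < k" "x \<in> ccube a k"
    and lt: "ennreal c < (\<integral>\<^sup>+y\<in>ccube a k. ennreal \<bar>f y\<bar> \<partial>lebesgue) / emeasure lebesgue (ccube a k)"
  proof -
    obtain Q where "Q \<in> cubes" "x \<in> Q"
      "ennreal c < (\<integral>\<^sup>+y\<in>Q. ennreal \<bar>f y\<bar> \<partial>lebesgue) / emeasure lebesgue Q"
      using assms(1) unfolding maximal_def less_SUP_iff by blast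
    then show ?thesis using that unfolding cubes_eq_ccube by blast
  qed
  define I where "I = (\<integral>\<^sup>+y\<in>ccube a k. ennreal \<bar>f y\<bar> \<partial>lebesgue)"
  have e: "emeasure lebesgue (ccube a k) = ennreal ((2 * k) ^ CARD('n))"
    using k by (intro emeasure_ccube) auto
  have I: "ennreal (c * (2 * k) ^ CARD('n)) < I"
  proof (rule ccontr)
    assume "\<not> ?thesis"
    then have "I / ennreal ((2 * k) ^ CARD('n)) \<le> ennreal (c * (2 * k) ^ CARD('n)) / ennreal ((2 * k) ^ CARD('n))"
      by (intro divide_right_mono_ennreal) auto
    also have "\<dots> = ennreal c" using k assms(2) by (simp add: divide_ennreal)
    finally show False using lt unfolding e I_def by auto
  qed
  have "((\<lambda>h. ennreal (c * (2 * h) ^ CARD('n))) \<longlongrightarrow> ennreal (c * (2 * k) ^ CARD('n))) (at_right k)"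
    by (intro tendsto_ennrealI tendsto_intros)
  then have "eventually (\<lambda>h. ennreal (c * (2 * h) ^ CARD('n)) < I) (at_right k)"
    using I by (rule order_tendstoD)
  moreover have "eventually (\<lambda>h. k < h) (at_right k)"
    by (rule eventually_at_right_less)
  ultimately have "eventually (\<lambda>h. k < h \<and> ennreal (c * (2 * h) ^ CARD('n)) < I) (at_right k)"
    by eventually_elim auto
  then obtain h where h: "k < h" "ennreal (c * (2 * h) ^ CARD('n)) < I"
    by (auto dest!: eventually_happens simp: trivial_limit_at_right_real)
  have "I \<le> (\<integral>\<^sup>+y\<in>ccube a h. ennreal \<bar>f y\<bar> \<partial>lebesgue)"
    unfolding I_def using ccube_mono[of k h a] h
    by (intro nn_integral_mono mult_left_mono) (auto simp: indicator_def)
  with h k show ?thesis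
    by (intro that[of h a]) (auto simp: mem_ocube mem_ccube intro: le_less_trans less_le_trans)
qed

text \<open>
  Each selected cube contains a point \<open>x\<close> with \<open>M w(x) \<le> W w(x)\<close> and \<open>M g(x) > l w(x)\<close>, and \<open>x\<close> also lies in the
  dilated cube. The first property bounds the \<open>w\<close>-mass of the dilated cube by \<open>W w(x)\<close> times its volume,
  the second bounds \<open>l w(x)\<close> times the volume of the original cube by its \<open>\<bar>g\<bar>\<close>-mass. The covering lemma then
  compares the measures with densities \<open>l \<bar>w\<bar>\<close> and \<open>c \<bar>g\<bar>\<close>.
\<close>

lemma weak_type_maximal_A1:
  fixes w g :: "real ^ 'n \<Rightarrow> real"
  assumes [measurable]: "w \<in> borel_measurable lebesgue" "g \<in> borel_measurable lebesgue"
    and W: "0 \<le> W" and l: "0 < l"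
  shows "ennreal l * wmeas w {x. 0 < w x \<and> maximal w x \<le> ennreal (W * w x) \<and> ennreal (l * w x) < maximal g x}
    \<le> ennreal ((5 * real CARD('n)) ^ CARD('n) * W) * (\<integral>\<^sup>+x. ennreal \<bar>g x\<bar> \<partial>lebesgue)"
proof -
  define n where "n = CARD('n)"
  define G where "G = {x. 0 < w x \<and> maximal w x \<le> ennreal (W * w x)}"
  define c where "c = (5 * real n) ^ n * W"
  have c: "0 \<le> c" using W by (simp add: c_def)
  define M where "M = density lebesgue (\<lambda>x. ennreal l * ennreal \<bar>w x\<bar>)"
  define N where "N = density lebesgue (\<lambda>x. ennreal c * ennreal \<bar>g x\<bar>)"
  define K where "K = {(a, h). 0 < h \<and> (\<exists>x\<in>G. x \<in> ocube a h \<and>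
    ennreal (l * w x * (2 * h) ^ n) < (\<integral>\<^sup>+y\<in>ccube a h. ennreal \<bar>g y\<bar> \<partial>lebesgue))}"
  define U where "U = (\<Union>(a, h)\<in>K. ocube a h)"
  have [measurable]: "U \<in> sets lebesgue"
    by (auto simp: U_def intro!: lborelD open_UN open_ocube borel_open)
  have eM: "emeasure M A = ennreal l * (\<integral>\<^sup>+x\<in>A. ennreal \<bar>w x\<bar> \<partial>lebesgue)"
    if [measurable]: "A \<in> sets lebesgue" for A
    unfolding M_def by (simp add: emeasure_density mult.assoc nn_integral_cmult)
  have eN: "emeasure N A = ennreal c * (\<integral>\<^sup>+x\<in>A. ennreal \<bar>g x\<bar> \<partial>lebesgue)"
    if [measurable]: "A \<in> sets lebesgue" for A
    unfolding N_def by (simp add: emeasure_density mult.assoc nn_integral_cmult)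
  have sub: "{x. 0 < w x \<and> maximal w x \<le> ennreal (W * w x) \<and> ennreal (l * w x) < maximal g x} \<subseteq> U"
  proof clarify
    fix x assume x: "0 < w x" "maximal w x \<le> ennreal (W * w x)" "ennreal (l * w x) < maximal g x"
    have "0 \<le> l * w x" using x(1) l by simp
    then obtain a h where "0 < h" "x \<in> ocube a h"
      "ennreal (l * w x * (2 * h) ^ CARD('n)) < (\<integral>\<^sup>+y\<in>ccube a h. ennreal \<bar>g y\<bar> \<partial>lebesgue)"
      by (rule maximal_gtE[OF x(3)])
    with x have "(a, h) \<in> K" "x \<in> ocube a h" by (auto simp: K_def G_def n_def)
    then show "x \<in> U" unfolding U_def by blast
  qed
  have comparison: "emeasure M U \<le> emeasure N UNIV"
    unfolding U_def
  proof (rule Vitali_cubes)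
    show "sets M = sets lebesgue" "sets N = sets lebesgue" by (simp_all add: M_def N_def)
    show "0 < h" if "(a, h) \<in> K" for a h using that by (simp add: K_def)
  next
    fix a h assume "(a, h) \<in> K"
    then obtain x where h: "0 < h" and x: "0 < w x" "maximal w x \<le> ennreal (W * w x)" "x \<in> ocube a h"
      and lt: "ennreal (l * w x * (2 * h) ^ n) < (\<integral>\<^sup>+y\<in>ccube a h. ennreal \<bar>g y\<bar> \<partial>lebesgue)"
      by (auto simp: K_def G_def)
    define H where "H = 5 * real CARD('n) * h"
    have "1 \<le> real CARD('n)" by (simp add: Suc_le_eq)
    then have "1 \<le> 5 * real CARD('n)" by linarith
    from mult_right_mono[OF this, of h] have "h \<le> H" unfolding H_def using h by simp
    then have H: "h \<le> H" "0 < H" using h by auto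
    have xH: "x \<in> ccube a H" using x(3) H(1) ocube_subset_ccube ccube_mono by blast
    define J where "J = (\<integral>\<^sup>+y\<in>ccube a H. ennreal \<bar>w y\<bar> \<partial>lebesgue)"
    have e: "emeasure lebesgue (ccube a H) = ennreal ((2 * H) ^ n)"
      unfolding n_def using H by (intro emeasure_ccube) auto
    have "J / ennreal ((2 * H) ^ n) \<le> ennreal (W * w x)"
      using maximal_ge_ccube[OF H(2) xH, of w] x(2) unfolding e J_def by (rule order.trans)
    then have "J / ennreal ((2 * H) ^ n) * ennreal ((2 * H) ^ n) \<le> ennreal (W * w x) * ennreal ((2 * H) ^ n)"
      by (intro mult_right_mono) auto
    then have "J \<le> ennreal (W * w x) * ennreal ((2 * H) ^ n)"
      using H by (simp add: ennreal_divide_times)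
    then have "ennreal l * J \<le> ennreal l * (ennreal (W * w x) * ennreal ((2 * H) ^ n))"
      by (intro mult_left_mono) auto
    also have "\<dots> = ennreal (l * (W * w x * (2 * H) ^ n))"
      using l W x H by (simp add: ennreal_mult)
    also have "l * (W * w x * (2 * H) ^ n) = c * (l * w x * (2 * h) ^ n)"
    proof -
      have "2 * H = (5 * real n) * (2 * h)" by (simp add: H_def n_def)
      then have "(2 * H) ^ n = (5 * real n) ^ n * (2 * h) ^ n" by (simp only: power_mult_distrib)
      then show ?thesis by (simp only: c_def mult_ac)
    qed
    also have "ennreal \<dots> = ennreal c * ennreal (l * w x * (2 * h) ^ n)"
      using c l x h by (simp add: ennreal_mult)
    also have "\<dots> \<le> ennreal c * (\<integral>\<^sup>+y\<in>ccube a h. ennreal \<bar>g y\<bar> \<partial>lebesgue)"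
      using lt by (intro mult_left_mono) auto
    finally show "emeasure M (ccube a (5 * real CARD('n) * h)) \<le> emeasure N (ccube a h)"
      by (simp add: eM eN J_def H_def)
  qed
  have "wmeas w {x. 0 < w x \<and> maximal w x \<le> ennreal (W * w x) \<and> ennreal (l * w x) < maximal g x}
      \<le> (\<integral>\<^sup>+x\<in>U. ennreal \<bar>w x\<bar> \<partial>lebesgue)"
    unfolding wmeas_def using sub
    by (intro nn_integral_mono) (auto simp: indicator_def intro!: ennreal_leI)
  then have "ennreal l * wmeas w {x. 0 < w x \<and> maximal w x \<le> ennreal (W * w x) \<and> ennreal (l * w x) < maximal g x}
      \<le> ennreal l * (\<integral>\<^sup>+x\<in>U. ennreal \<bar>w x\<bar> \<partial>lebesgue)"
    by (rule mult_left_mono) simp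
  also have "\<dots> = emeasure M U" by (rule eM[symmetric]) measurable
  also note comparison
  also have "emeasure N UNIV = ennreal c * (\<integral>\<^sup>+x. ennreal \<bar>g x\<bar> \<partial>lebesgue)"
    using eN[of UNIV] by simp
  finally show ?thesis by (simp only: c_def n_def)
qed

section \<open>Truncation and interpolation\<close>

lemma sigma_finite_lebesgue: "sigma_finite_measure (lebesgue :: 'a::euclidean_space measure)"
proof
  obtain A :: "'a set set" where A: "countable A" "A \<subseteq> sets lborel" "\<Union>A = space lborel"
    "\<forall>a\<in>A. emeasure lborel a \<noteq> \<infinity>"
    using sigma_finite_measure.sigma_finite_countable[OF sigma_finite_lborel] by blast
  then show "\<exists>A :: 'a set set. countable A \<and> A \<subseteq> sets lebesgue \<and> \<Union>A = space lebesgue \<and>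
      (\<forall>a\<in>A. emeasure lebesgue a \<noteq> (\<infinity>::ennreal))"
    by (intro exI[of _ A]) auto
qed

lemma (in sigma_finite_measure) nn_integral_excess_layer_cake:
  assumes [measurable]: "f \<in> borel_measurable M" "V \<in> borel_measurable M" and s: "0 \<le> s"
  shows "(\<integral>\<^sup>+x. ennreal (max 0 (\<bar>f x\<bar> - s)) * V x \<partial>M)
    = (\<integral>\<^sup>+u\<in>{s..}. (\<integral>\<^sup>+x\<in>{x. ennreal \<bar>f x\<bar> > ennreal u}. V x \<partial>M) \<partial>lborel)"
proof -
  interpret pair_sigma_finite M lborel ..
  have "(\<integral>\<^sup>+x. ennreal (max 0 (\<bar>f x\<bar> - s)) * V x \<partial>M)
    = (\<integral>\<^sup>+x. \<integral>\<^sup>+u. (if s \<le> u \<and> u < \<bar>f x\<bar> then V x else 0) \<partial>lborel \<partial>M)"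
  proof (intro nn_integral_cong)
    fix x
    have "(\<integral>\<^sup>+u. (if s \<le> u \<and> u < \<bar>f x\<bar> then V x else 0) \<partial>lborel)
        = (\<integral>\<^sup>+u. V x * indicator {s..<\<bar>f x\<bar>} u \<partial>lborel)"
      by (intro nn_integral_cong) (auto simp: indicator_def)
    also have "\<dots> = V x * emeasure lborel {s..<\<bar>f x\<bar>}"
      by (intro nn_integral_cmult_indicator) auto
    also have "emeasure lborel {s..<\<bar>f x\<bar>} = ennreal (max 0 (\<bar>f x\<bar> - s))"
      by (cases "s \<le> \<bar>f x\<bar>") auto
    finally show "ennreal (max 0 (\<bar>f x\<bar> - s)) * V x
        = (\<integral>\<^sup>+u. (if s \<le> u \<and> u < \<bar>f x\<bar> then V x else 0) \<partial>lborel)"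
      by (simp add: mult.commute)
  qed
  also have "\<dots> = (\<integral>\<^sup>+u. \<integral>\<^sup>+x. (if s \<le> u \<and> u < \<bar>f x\<bar> then V x else 0) \<partial>M \<partial>lborel)"
    by (rule Fubini'[symmetric]) measurable
  also have "\<dots> = (\<integral>\<^sup>+u\<in>{s..}. (\<integral>\<^sup>+x\<in>{x. ennreal \<bar>f x\<bar> > ennreal u}. V x \<partial>M) \<partial>lborel)"
  proof (intro nn_integral_cong)
    fix u
    show "(\<integral>\<^sup>+x. (if s \<le> u \<and> u < \<bar>f x\<bar> then V x else 0) \<partial>M)
      = (\<integral>\<^sup>+x\<in>{x. ennreal \<bar>f x\<bar> > ennreal u}. V x \<partial>M) * indicator {s..} u"
    proof (cases "s \<le> u")
      case True
      then show ?thesis using s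
        by (auto intro!: nn_integral_cong simp: indicator_def ennreal_less_iff)
    next
      case False
      then have "(\<lambda>x. if s \<le> u \<and> u < \<bar>f x\<bar> then V x else 0) = (\<lambda>x. 0)" by (intro ext) auto
      with False show ?thesis by simp
    qed
  qed
  finally show ?thesis .
qed

lemma maximal_le_add_truncation:
  fixes f v :: "real ^ 'n \<Rightarrow> real"
  assumes [measurable]: "f \<in> borel_measurable lebesgue" "v \<in> borel_measurable lebesgue"
    and s: "0 \<le> s"
  shows "maximal (\<lambda>y. f y * v y) x
    \<le> ennreal s * maximal v x + maximal (\<lambda>y. max 0 (\<bar>f y\<bar> - s) * v y) x"
  unfolding maximal_def[of "\<lambda>y. f y * v y"]
proof (rule SUP_least)
  fix Q :: "(real ^ 'n) set" assume "Q \<in> {Q \<in> cubes. x \<in> Q}"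
  then have Q: "Q \<in> cubes" "x \<in> Q" by auto
  then obtain a h where ah: "0 < h" "Q = ccube a h" by (auto simp: cubes_eq_ccube)
  then have [measurable]: "Q \<in> sets lebesgue" by simp
  let ?m = "emeasure lebesgue Q"
  have "(\<integral>\<^sup>+y\<in>Q. ennreal \<bar>f y * v y\<bar> \<partial>lebesgue)
    \<le> (\<integral>\<^sup>+y. ennreal s * (ennreal \<bar>v y\<bar> * indicator Q y)
        + ennreal \<bar>max 0 (\<bar>f y\<bar> - s) * v y\<bar> * indicator Q y \<partial>lebesgue)"
  proof (intro nn_integral_mono)
    fix y
    have "\<bar>f y\<bar> * \<bar>v y\<bar> \<le> (s + max 0 (\<bar>f y\<bar> - s)) * \<bar>v y\<bar>" by (intro mult_right_mono) auto
    then have "\<bar>f y * v y\<bar> \<le> s * \<bar>v y\<bar> + \<bar>max 0 (\<bar>f y\<bar> - s) * v y\<bar>"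
      by (simp add: abs_mult distrib_right)
    then show "ennreal \<bar>f y * v y\<bar> * indicator Q y \<le> ennreal s * (ennreal \<bar>v y\<bar> * indicator Q y)
        + ennreal \<bar>max 0 (\<bar>f y\<bar> - s) * v y\<bar> * indicator Q y"
      using s by (auto simp: indicator_def simp flip: ennreal_mult ennreal_plus)
  qed
  also have "\<dots> = ennreal s * (\<integral>\<^sup>+y\<in>Q. ennreal \<bar>v y\<bar> \<partial>lebesgue)
      + (\<integral>\<^sup>+y\<in>Q. ennreal \<bar>max 0 (\<bar>f y\<bar> - s) * v y\<bar> \<partial>lebesgue)"
    by (simp add: nn_integral_add nn_integral_cmult)
  finally have "(\<integral>\<^sup>+y\<in>Q. ennreal \<bar>f y * v y\<bar> \<partial>lebesgue) / ?m
      \<le> (ennreal s * (\<integral>\<^sup>+y\<in>Q. ennreal \<bar>v y\<bar> \<partial>lebesgue)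
      + (\<integral>\<^sup>+y\<in>Q. ennreal \<bar>max 0 (\<bar>f y\<bar> - s) * v y\<bar> \<partial>lebesgue)) / ?m"
    by (rule divide_right_mono_ennreal)
  also have "\<dots> = ennreal s * ((\<integral>\<^sup>+y\<in>Q. ennreal \<bar>v y\<bar> \<partial>lebesgue) / ?m)
      + (\<integral>\<^sup>+y\<in>Q. ennreal \<bar>max 0 (\<bar>f y\<bar> - s) * v y\<bar> \<partial>lebesgue) / ?m"
    by (simp only: add_divide_distrib_ennreal ennreal_times_divide)
  also have "\<dots> \<le> ennreal s * maximal v x + maximal (\<lambda>y. max 0 (\<bar>f y\<bar> - s) * v y) x"
    unfolding ah(2) using ah Q by (intro add_mono mult_left_mono maximal_ge_ccube) auto
  finally show "(\<integral>\<^sup>+y\<in>Q. ennreal \<bar>f y * v y\<bar> \<partial>lebesgue) / ?m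
      \<le> ennreal s * maximal v x + maximal (\<lambda>y. max 0 (\<bar>f y\<bar> - s) * v y) x" .
qed

lemma AE_maximal_le_A1_const:
  assumes "weight w" "A1_const v w < \<infinity>"
  shows "AE x in lebesgue. 0 < w x \<and> maximal v x \<le> ennreal (enn2real (A1_const v w) * w x)"
proof -
  have "AE x in lebesgue. maximal v x / ennreal (w x) \<le> A1_const v w"
    unfolding A1_const_def by (rule esssup_AE)
  moreover have "AE x in lebesgue. 0 < w x" using assms by (simp add: weight_def)
  ultimately show ?thesis
  proof eventually_elim
    case (elim x)
    have "maximal v x = maximal v x / ennreal (w x) * ennreal (w x)"
      using elim by (simp add: ennreal_divide_times)
    also have "\<dots> \<le> A1_const v w * ennreal (w x)" using elim by (intro mult_right_mono) auto
    also have "A1_const v w = ennreal (enn2real (A1_const v w))" using assms by simp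
    finally show ?case using elim by (simp add: ennreal_mult)
  qed
qed

text \<open>
  At almost every point, the truncation of \<open>f\<close> at height \<open>s\<close> contributes at most \<open>A s \<le> B s\<close> to the
  weighted maximal function. So where the latter exceeds \<open>2 B s\<close>, the excess \<open>(\<bar>f\<bar> - s)\<^sup>+\<close> alone contributes
  more than \<open>B s\<close>, and the weak type bound applies with \<open>l = B s\<close>. Using \<open>B = 1 + A\<close> rather than \<open>A\<close>
  ensures \<open>B \<ge> 1\<close>, which is what allows the factor \<open>B\<close> to \<open>1 - 1/r\<close> to be absorbed in \<open>B\<close>.
\<close>

lemma distribution_weighted_maximal_le:
  fixes v w f :: "real ^ 'n \<Rightarrow> real"
  assumes v: "weight v" and w: "weight w"
    and A1: "A1_const v w < \<infinity>" "A1_const w w < \<infinity>"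
    and [measurable]: "f \<in> borel_measurable lebesgue" and s: "0 < s"
  defines "B \<equiv> 1 + enn2real (A1_const v w)"
    and "K \<equiv> (5 * real CARD('n)) ^ CARD('n) * enn2real (A1_const w w)"
  shows "wmeas w {x. weighted_maximal v w f x > ennreal (2 * B * s)}
    \<le> ennreal (K / B) *
       ((\<integral>\<^sup>+u\<in>{s..}. wmeas v {x. ennreal \<bar>f x\<bar> > ennreal u} \<partial>lborel) / ennreal s)"
proof -
  define A W where "A = enn2real (A1_const v w)" and "W = enn2real (A1_const w w)"
  have [measurable]: "v \<in> borel_measurable lebesgue" "w \<in> borel_measurable lebesgue"
    using v w by (auto simp: weight_def)
  have nn: "0 \<le> A" "0 \<le> W" "0 < B" "B = 1 + A" "0 \<le> K" by (auto simp: A_def W_def B_def K_def add_pos_nonneg)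
  define g where "g = (\<lambda>y. max 0 (\<bar>f y\<bar> - s) * v y)"
  have [measurable]: "g \<in> borel_measurable lebesgue" unfolding g_def by measurable
  define E where "E = {x. 0 < w x \<and> maximal w x \<le> ennreal (W * w x) \<and> ennreal (B * s * w x) < maximal g x}"
  define T where "T = {x. weighted_maximal v w f x > ennreal (2 * B * s)}"
  define H where "H = (\<integral>\<^sup>+u\<in>{s..}. wmeas v {x. ennreal \<bar>f x\<bar> > ennreal u} \<partial>lborel)"
  have "AE x in lebesgue. x \<in> T \<longrightarrow> x \<in> E"
    using AE_maximal_le_A1_const[OF w A1(1)] AE_maximal_le_A1_const[OF w A1(2)]
  proof eventually_elim
    case (elim x)
    have "weighted_maximal v w f x \<le> ennreal (2 * B * s)" if "maximal g x \<le> ennreal (B * s * w x)"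
    proof -
      have "maximal (\<lambda>y. f y * v y) x \<le> ennreal s * maximal v x + maximal g x"
        unfolding g_def using s by (intro maximal_le_add_truncation) auto
      also have "\<dots> \<le> ennreal s * ennreal (A * w x) + ennreal (B * s * w x)"
        using elim that by (intro add_mono mult_left_mono) (auto simp: A_def)
      also have "\<dots> = ennreal (s * (A * w x) + B * s * w x)"
        using elim nn s by (simp flip: ennreal_mult ennreal_plus)
      also have "\<dots> \<le> ennreal (2 * B * s * w x)"
        using elim nn s by (intro ennreal_leI) (simp add: algebra_simps)
      finally have "weighted_maximal v w f x \<le> ennreal (2 * B * s * w x) / ennreal (w x)"
        unfolding weighted_maximal_def by (intro divide_right_mono_ennreal)
      also have "\<dots> = ennreal (2 * B * s)"
        using elim nn s by (simp add: divide_ennreal)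
      finally show ?thesis .
    qed
    then show ?case using elim unfolding T_def E_def W_def by force
  qed
  then have "wmeas w T \<le> wmeas w E"
    unfolding wmeas_def by (intro nn_integral_mono_AE) (auto simp: indicator_def elim!: eventually_mono)
  moreover have "ennreal (B * s) * wmeas w E \<le> ennreal K * (\<integral>\<^sup>+x. ennreal \<bar>g x\<bar> \<partial>lebesgue)"
    unfolding E_def K_def W_def[symmetric] using nn s by (intro weak_type_maximal_A1) auto
  moreover have "(\<integral>\<^sup>+x. ennreal \<bar>g x\<bar> \<partial>lebesgue) = H"
  proof -
    have "(\<integral>\<^sup>+x. ennreal \<bar>g x\<bar> \<partial>lebesgue)
        = (\<integral>\<^sup>+x. ennreal (max 0 (\<bar>f x\<bar> - s)) * ennreal (v x) \<partial>lebesgue)"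
      using v unfolding weight_def g_def
      by (intro nn_integral_cong_AE) (auto simp: abs_mult elim!: eventually_mono simp flip: ennreal_mult)
    then show ?thesis
      unfolding H_def wmeas_def
      using s by (simp add: sigma_finite_measure.nn_integral_excess_layer_cake[OF sigma_finite_lebesgue])
  qed
  ultimately have "ennreal (B * s) * wmeas w T \<le> ennreal K * H"
    by (metis mult_left_mono order.trans zero_le)
  then have "ennreal (1 / (B * s)) * (ennreal (B * s) * wmeas w T) \<le> ennreal (1 / (B * s)) * (ennreal K * H)"
    by (intro mult_left_mono) auto
  also have "ennreal (1 / (B * s)) * (ennreal (B * s) * wmeas w T) = wmeas w T"
    using nn s by (simp flip: mult.assoc ennreal_mult)
  also have "ennreal (1 / (B * s)) * (ennreal K * H) = ennreal (K / B) * (H / ennreal s)"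
    using nn s by (simp add: divide_ennreal_pos mult_ac flip: ennreal_mult)
  finally show ?thesis unfolding T_def H_def .
qed

lemma lorentz_norm_eq:
  "lorentz_norm r t w g = epowr (ennreal r *
     (\<integral>\<^sup>+l\<in>{0<..}. ennreal (l powr (t - 1)) * epowr (wmeas w {x. g x > ennreal l}) (t / r) \<partial>lborel)) (1 / t)"
proof -
  have "ennreal (l powr t) * X / ennreal l = ennreal (l powr (t - 1)) * X" if "0 < l" for l X
  proof -
    have "l powr t * (1 / l) = l powr (t - 1)" using that by (simp add: powr_diff)
    from arg_cong[OF this, of ennreal] have "ennreal (l powr t) * ennreal (1 / l) = ennreal (l powr (t - 1))"
      using that by (simp only: ennreal_mult powr_ge_zero divide_nonneg_nonneg less_imp_le zero_le_one)
    then have "X * (ennreal (l powr t) * ennreal (1 / l)) = X * ennreal (l powr (t - 1))" by simp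
    then show ?thesis
      using that by (simp only: divide_ennreal_pos mult_ac)
  qed
  then have "(\<integral>\<^sup>+l\<in>{0<..}. ennreal (l powr t) * epowr (wmeas w {x. g x > ennreal l}) (t / r) / ennreal l \<partial>lborel)
    = (\<integral>\<^sup>+l\<in>{0<..}. ennreal (l powr (t - 1)) * epowr (wmeas w {x. g x > ennreal l}) (t / r) \<partial>lborel)"
    by (intro nn_integral_cong) (auto simp: indicator_def)
  then show ?thesis unfolding lorentz_norm_def by (simp only:)
qed

lemma antimono_distribution: "antimono (\<lambda>l. wmeas w {x. g x > ennreal l})"
  unfolding wmeas_def
  by (intro antimonoI nn_integral_mono mult_left_mono)
     (auto simp: indicator_def intro: le_less_trans[OF ennreal_leI])

text \<open>
  The bound on the distribution function at height \<open>2 B s\<close> is raised to the power \<open>t / r\<close> and integrated;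
  the substitution \<open>l = 2 B s\<close> contributes \<open>(2 B)\<^sup>t\<close>, and the Hardy inequality bounds what remains by the
  Lorentz integral of \<open>f\<close>.
\<close>

lemma lorentz_norm_weighted_maximal_le:
  fixes v w f :: "real ^ 'n \<Rightarrow> real"
  assumes v: "weight v" and w: "weight w"
    and A1: "A1_const v w < \<infinity>" "A1_const w w < \<infinity>"
    and f: "f \<in> borel_measurable lebesgue" and r: "1 < r" and t: "1 < t"
  shows "lorentz_norm r t w (weighted_maximal v w f)
    \<le> ennreal (6 * (5 * real CARD('n)) ^ CARD('n) * (r / (r - 1)) powr (1 / min r t)
        * (1 + enn2real (A1_const v w)) * enn2real (A1_const w w) powr (1 / r))
      * lorentz_norm r t v (\<lambda>x. ennreal \<bar>f x\<bar>)"
proof -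
  define c W where "c = (5 * real CARD('n)) ^ CARD('n)" and "W = enn2real (A1_const w w)"
  define B K where "B = 1 + enn2real (A1_const v w)" and "K = c * W"
  define p m where "p = r / (r - 1)" and "m = min r t"
  define G where "G = (\<lambda>l. wmeas w {x. weighted_maximal v w f x > ennreal l})"
  define d where "d = (\<lambda>u. wmeas v {x. ennreal \<bar>f x\<bar> > ennreal u})"
  define H where "H = (\<lambda>s. (\<integral>\<^sup>+u\<in>{s..}. d u \<partial>lborel) / ennreal s)"
  define J where "J = (\<integral>\<^sup>+s\<in>{0<..}. ennreal (s powr (t - 1)) * epowr (d s) (t / r) \<partial>lborel)"
  have B: "1 \<le> B" and W: "0 \<le> W" by (auto simp: B_def W_def)
  have c: "1 \<le> c" unfolding c_def
    by (intro one_le_power) (use one_le_card_finite[where 'a='n] in linarith)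
  have K: "0 \<le> K" using c W by (simp add: K_def)
  have p: "0 < p" using r by (simp add: p_def)
  have "antimono G" "antimono d" unfolding G_def d_def by (rule antimono_distribution)+
  then have [measurable]: "G \<in> borel_measurable borel" "d \<in> borel_measurable borel"
    by (auto intro: borel_measurable_antimono)
  have [measurable]: "H \<in> borel_measurable borel" unfolding H_def by measurable
  have GH: "G (2 * B * s) \<le> ennreal (K / B) * H s" if "0 < s" for s
    unfolding G_def B_def K_def c_def W_def H_def d_def
    using distribution_weighted_maximal_le[OF v w A1 f that] .
  have "(\<integral>\<^sup>+l\<in>{0<..}. ennreal (l powr (t - 1)) * epowr (G l) (t / r) \<partial>lborel)
      = ennreal (2 * B) * (\<integral>\<^sup>+s. ennreal ((2 * B * s) powr (t - 1)) * epowr (G (2 * B * s)) (t / r)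
          * indicator {0<..} (2 * B * s) \<partial>lborel)"
    using B nn_integral_real_affine[of "\<lambda>l. ennreal (l powr (t - 1)) * epowr (G l) (t / r)
      * indicator {0<..} l" "2 * B" 0] by simp
  also have "\<dots> \<le> ennreal (2 * B) * (\<integral>\<^sup>+s. ennreal ((2 * B) powr (t - 1) * (K / B) powr (t / r)) *
      (ennreal (s powr (t - 1)) * epowr (H s) (t / r) * indicator {0<..} s) \<partial>lborel)"
  proof (intro mult_left_mono nn_integral_mono)
    fix s :: real
    show "ennreal ((2 * B * s) powr (t - 1)) * epowr (G (2 * B * s)) (t / r) * indicator {0<..} (2 * B * s)
      \<le> ennreal ((2 * B) powr (t - 1) * (K / B) powr (t / r)) *
        (ennreal (s powr (t - 1)) * epowr (H s) (t / r) * indicator {0<..} s)"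
    proof (cases "0 < s")
      case True
      have "epowr (G (2 * B * s)) (t / r) \<le> epowr (ennreal (K / B) * H s) (t / r)"
        using GH[OF True] r t by (intro epowr_mono) auto
      also have "\<dots> = ennreal ((K / B) powr (t / r)) * epowr (H s) (t / r)"
        using K B by (simp add: epowr_mult epowr_ennreal)
      finally have "ennreal ((2 * B * s) powr (t - 1)) * epowr (G (2 * B * s)) (t / r)
        \<le> ennreal ((2 * B * s) powr (t - 1)) * (ennreal ((K / B) powr (t / r)) * epowr (H s) (t / r))"
        by (intro mult_left_mono) auto
      also have "\<dots> = ennreal ((2 * B) powr (t - 1) * (K / B) powr (t / r)) *
        (ennreal (s powr (t - 1)) * epowr (H s) (t / r))"
      proof -
        have "(2 * B * s) powr (t - 1) = (2 * B) powr (t - 1) * s powr (t - 1)"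
          using True B by (simp only: powr_mult)
        then show ?thesis by (simp only: ennreal_mult powr_ge_zero mult_ac)
      qed
      finally show ?thesis using True B by simp
    next
      case False
      then have "\<not> 0 < 2 * B * s" using B by (simp add: zero_less_mult_iff)
      with False show ?thesis by simp
    qed
  qed auto
  also have "\<dots> = ennreal ((2 * B) powr t * (K / B) powr (t / r)) *
      (\<integral>\<^sup>+s\<in>{0<..}. ennreal (s powr (t - 1)) * epowr (H s) (t / r) \<partial>lborel)"
  proof -
    have "2 * B * ((2 * B) powr (t - 1) * (K / B) powr (t / r)) = (2 * B) powr t * (K / B) powr (t / r)"
      using B by (simp add: powr_diff)
    from arg_cong[OF this, of ennreal] show ?thesis
      using B by (subst nn_integral_cmult) (simp_all add: ennreal_mult flip: mult.assoc)
  qed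
  also have "\<dots> \<le> ennreal ((2 * B) powr t * (K / B) powr (t / r)) * (ennreal (3 powr t * p powr (t / m)) * J)"
    unfolding H_def J_def p_def m_def
    by (intro mult_left_mono Hardy_tail r t \<open>antimono d\<close>) auto
  also have "\<dots> = ennreal ((2 * B) powr t * (K / B) powr (t / r) * (3 powr t * p powr (t / m))) * J"
    by (simp add: ennreal_mult mult.assoc)
  finally have "ennreal r * (\<integral>\<^sup>+l\<in>{0<..}. ennreal (l powr (t - 1)) * epowr (G l) (t / r) \<partial>lborel)
    \<le> ennreal r * (ennreal ((2 * B) powr t * (K / B) powr (t / r) * (3 powr t * p powr (t / m))) * J)"
    by (intro mult_left_mono) auto
  then have "lorentz_norm r t w (weighted_maximal v w f)
    \<le> epowr (ennreal r * (ennreal ((2 * B) powr t * (K / B) powr (t / r) * (3 powr t * p powr (t / m))) * J)) (1 / t)"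
    unfolding lorentz_norm_eq G_def using t by (intro epowr_mono) auto
  also have "\<dots> = epowr (ennreal ((2 * B) powr t * (K / B) powr (t / r) * (3 powr t * p powr (t / m)))) (1 / t)
      * epowr (ennreal r * J) (1 / t)"
    by (simp add: mult.left_commute flip: epowr_mult)
  also have "epowr (ennreal r * J) (1 / t) = lorentz_norm r t v (\<lambda>x. ennreal \<bar>f x\<bar>)"
    by (simp add: lorentz_norm_eq J_def d_def)
  also have "epowr (ennreal ((2 * B) powr t * (K / B) powr (t / r) * (3 powr t * p powr (t / m)))) (1 / t)
      = ennreal (2 * B * (K / B) powr (1 / r) * (3 * p powr (1 / m)))"
  proof -
    have "((2 * B) powr t * (K / B) powr (t / r) * (3 powr t * p powr (t / m))) powr (1 / t)
        = ((2 * B) powr t) powr (1 / t) * ((K / B) powr (t / r)) powr (1 / t)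
          * ((3 powr t) powr (1 / t) * (p powr (t / m)) powr (1 / t))"
      by (simp only: powr_mult)
    also have "\<dots> = 2 * B * (K / B) powr (1 / r) * (3 * p powr (1 / m))"
      using t B by (simp add: powr_powr)
    finally show ?thesis by (subst epowr_ennreal) auto
  qed
  also have "2 * B * (K / B) powr (1 / r) * (3 * p powr (1 / m))
      \<le> 6 * c * p powr (1 / m) * B * W powr (1 / r)"
  proof -
    have "(K / B) powr (1 / r) \<le> K powr (1 / r)"
      using B K r by (intro powr_mono2) (auto simp: divide_le_eq mult_left_le mult_right_mono intro: order.trans[of _ "K * 1"] mult_left_mono)
    also have "\<dots> = c powr (1 / r) * W powr (1 / r)"
      using c W by (simp add: K_def powr_mult)
    also have "\<dots> \<le> c powr 1 * W powr (1 / r)"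
      using c r by (intro mult_right_mono powr_mono) auto
    finally have "(K / B) powr (1 / r) \<le> c * W powr (1 / r)" using c by simp
    then have "(6 * B * p powr (1 / m)) * (K / B) powr (1 / r) \<le> (6 * B * p powr (1 / m)) * (c * W powr (1 / r))"
      using B by (intro mult_left_mono) auto
    then show ?thesis by (simp add: mult_ac)
  qed
  finally show ?thesis
    unfolding c_def W_def B_def p_def m_def
    by (meson ennreal_leI mult_right_mono order.trans zero_le)
qed

theorem corollary2p5:
  shows "\<exists>C>0. \<forall>(p::real) (q::real) (v :: real ^ 'n \<Rightarrow> real) (w :: real ^ 'n \<Rightarrow> real).
    1 < p \<longrightarrow> 1 < q \<longrightarrow> weight v \<longrightarrow> weight w \<longrightarrow> A1_const v w < \<infinity> \<longrightarrow> A1_const w w < \<infinity> \<longrightarrow>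
      lorentz_op_norm (conj_exp p) (conj_exp q) v w (weighted_maximal v w)
      \<le> ennreal (C
          * p powr (1 / min (conj_exp p) (conj_exp q))
          * ln (exp 1 + enn2real (A1_const v w)) powr (1 / min (conj_exp p) (conj_exp q))
          * (1 + enn2real (A1_const v w))
          * enn2real (A1_const w w) powr (1 / conj_exp p))"
proof (intro exI[of _ "6 * (5 * real CARD('n)) ^ CARD('n)"] conjI allI impI)
  show "0 < 6 * (5 * real CARD('n)) ^ CARD('n)" by simp
next
  fix p q :: real and v w :: "real ^ 'n \<Rightarrow> real"
  assume p: "1 < p" and q: "1 < q" and v: "weight v" and w: "weight w"
    and A1: "A1_const v w < \<infinity>" "A1_const w w < \<infinity>"
  define r t where "r = conj_exp p" and "t = conj_exp q"
  have r: "1 < r" and t: "1 < t" and p_eq: "r / (r - 1) = p"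
    using p q by (auto simp: r_def t_def conj_exp_def field_simps)
  define c0 where "c0 = 6 * (5 * real CARD('n)) ^ CARD('n)"
  define A W where "A = enn2real (A1_const v w)" and "W = enn2real (A1_const w w)"
  define L where "L = ln (exp 1 + A) powr (1 / min r t)"
  (* The logarithmic factor is at least 1, so the bound may be multiplied by it. *)
  have "1 \<le> ln (exp 1 + A)" by (simp add: A_def ln_ge_iff add_pos_nonneg)
  then have L: "1 \<le> L" unfolding L_def using r t by (intro ge_one_powr_ge_zero) auto
  have c0: "0 < c0" by (simp add: c0_def)
  have "c0 * p powr (1 / min r t) * (1 + A) * W powr (1 / r) * 1
      \<le> c0 * p powr (1 / min r t) * (1 + A) * W powr (1 / r) * L"
    using L c0 by (intro mult_left_mono) (auto simp: A_def)
  then have le: "c0 * p powr (1 / min r t) * (1 + A) * W powr (1 / r)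
      \<le> c0 * p powr (1 / min r t) * L * (1 + A) * W powr (1 / r)"
    by (simp add: mult_ac)
  have "lorentz_op_norm r t v w (weighted_maximal v w)
      \<le> ennreal (c0 * p powr (1 / min r t) * (1 + A) * W powr (1 / r))"
    unfolding lorentz_op_norm_def
  proof (rule SUP_least)
    fix f assume "f \<in> {f \<in> lorentz_space r t v. \<not> (AE x in lebesgue. f x = 0)}"
    then have f: "f \<in> borel_measurable lebesgue" and fin: "lorentz_norm r t v (\<lambda>x. ennreal \<bar>f x\<bar>) < top"
      by (auto simp: lorentz_space_def)
    let ?N = "lorentz_norm r t v (\<lambda>x. ennreal \<bar>f x\<bar>)"
    have le: "lorentz_norm r t w (weighted_maximal v w f)
        \<le> ennreal (c0 * p powr (1 / min r t) * (1 + A) * W powr (1 / r)) * ?N"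
      using lorentz_norm_weighted_maximal_le[OF v w A1 f r t]
      by (simp add: p_eq c0_def A_def W_def)
    show "lorentz_norm r t w (weighted_maximal v w f) / ?N
        \<le> ennreal (c0 * p powr (1 / min r t) * (1 + A) * W powr (1 / r))"
    proof (cases "?N = 0")
      case True
      (* Then the numerator vanishes as well, and 0 / 0 = 0. *)
      with le show ?thesis by simp
    next
      case False
      with divide_right_mono_ennreal[OF le, of ?N] fin show ?thesis
        by (simp add: mult_divide_eq_ennreal)
    qed
  qed
  also have "\<dots> \<le> ennreal (c0 * p powr (1 / min r t) * L * (1 + A) * W powr (1 / r))"
    using le by (rule ennreal_leI)
  finally show "lorentz_op_norm (conj_exp p) (conj_exp q) v w (weighted_maximal v w)
      \<le> ennreal (6 * (5 * real CARD('n)) ^ CARD('n)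
          * p powr (1 / min (conj_exp p) (conj_exp q))
          * ln (exp 1 + enn2real (A1_const v w)) powr (1 / min (conj_exp p) (conj_exp q))
          * (1 + enn2real (A1_const v w))
          * enn2real (A1_const w w) powr (1 / conj_exp p))"
    by (simp add: r_def t_def c0_def A_def W_def L_def)
qed

end
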